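(* (a) The class $K_1$ is faithful. (b) For every $(X_1,G_1),(X_2,G_2)\in K$ and every group isomorphism $\varphi:G_1\to G_2$ there is a homeomorphism $\tau$ from $D(X_1,G_1)$ onto $D(X_2,G_2)$ such that for every $g\in G_1$, $$\varphi(g)\restriction D(X_2,G_2)=\tau\circ\bigl(g\restriction D(X_1,G_1)\bigr)\circ\tau^{-1}.$$
   Context: For a topological space $X$, $H(X)$ is the group of all auto-homeomorphisms of $X$; $\mathrm{Nbr}(x)$ is the set of open neighborhoods of $x$. A space-group pair is a pair $(X,G)$ where $X$ is a topological space and $G$ is a subgroup of $H(X)$. A class $K$ of space-group pairs is faithful if for every $(X,G),(Y,H)\in K$ and every group isomorphism $\varphi:G\to H$ there is a homeomorphism $\tau$ from $X$ onto $Y$ such that $\varphi(g)=\tau\circ g\circ\tau^{-1}$ for every $g\in G$. A set is somewhere dense if its closure has nonempty interior. Regular spaces are understood to be Hausdorff. A subset $A\subseteq X$ is discrete if it has no accumulation points in $X$. Let $(X,G)$ be a space-group pair. - $G$ is a locally moving group of $X$ if for every nonempty open $U\subseteq X$ there is $g\in G\setminus\{\mathrm{Id}\}$ with $g\restriction(X\setminus U)=\mathrm{Id}$. - For $A\subseteq X$ infinite and $V\subseteq X$ open nonempty, $V$ dissects $A$ if for every open nonempty $W\subseteq V$ there is $g\in G$ such that $\{a\in A : g(a)\in W\}$ is infinite and $\{a\in A : \text{there is } S\in\mathrm{Nbr}(a) \text{ with } g\restriction S=\mathrm{Id}\}$ is infinite. $A$ is dissectable if some such $V$ dissects $A$. -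 An open $U\subseteq X$ is flexible if there is a dense subset $D\subseteq U$ such that every infinite discrete subset of $D$ is dissectable. - $D(X,G)$ is the set of all $x\in X$ such that $\{g(x) : g\in G\}$ is somewhere dense. - $\mathrm{DF}_{X,G}(x,y)$ holds if $\{g(x) : g\in G \text{ and there is } U\in\mathrm{Nbr}(y) \text{ such that } g\restriction U=\mathrm{Id}\}$ is somewhere dense. $K_1$ is the class of all $(X,G)$ such that: (P1) $X$ is regular and first countable; (P2) $G$ is a locally moving group of $X$; (P3) for every distinct $x,y\in X$, $\mathrm{DF}_{X,G}(x,y)$ holds; (P4) the set of flexible subsets of $X$ is a cover of $X$. $K$ is the class of all $(X,G)$ satisfying (P1), (P2), (P4) and: (Q1) $D(X,G)$ is dense in $X$; (Q2) for every distinct $x,y\in D(X,G)$, $\mathrm{DF}_{X,G}(x,y)$ or $\mathrm{DF}_{X,G}(y,x)$ holds. *)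

theory Defs
  imports "HOL-Analysis.Analysis" "HOL-Algebra.Bij"
begin

text \<open>
  As in \<open>BijGroup\<close>, an auto-homeomorphism of X is represented by a function that is
  \<open>undefined\<close> off \<open>topspace X\<close>, so that equality of group elements is equality of maps on
  the space.
\<close>

definition homeo_group :: "'a topology \<Rightarrow> ('a \<Rightarrow> 'a) monoid" where
  "homeo_group X =
     (BijGroup (topspace X)) \<lparr>carrier := {g \<in> Bij (topspace X). homeomorphic_map X X g}\<rparr>"

lemma subgroup_homeo:
  "subgroup {g \<in> Bij (topspace X). homeomorphic_map X X g} (BijGroup (topspace X))"
proof -
  interpret B: group "BijGroup (topspace X)" by (rule group_BijGroup)
  let ?S = "topspace X"
  have restr: "homeomorphic_map X X (restrict f ?S)" if "homeomorphic_map X X f" for f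
    using homeomorphic_map_eq[OF that, of "restrict f ?S"] by simp
  show ?thesis
  proof (rule B.subgroupI)
    show "{g \<in> Bij ?S. homeomorphic_map X X g} \<subseteq> carrier (BijGroup ?S)"
      by (auto simp: BijGroup_def)
    have "restrict id ?S \<in> Bij ?S"
      using id_Bij[of ?S] by (simp add: id_def)
    moreover have "homeomorphic_map X X (restrict id ?S)"
      by (intro restr) simp
    ultimately show "{g \<in> Bij ?S. homeomorphic_map X X g} \<noteq> {}" by blast
  next
    fix a assume a: "a \<in> {g \<in> Bij ?S. homeomorphic_map X X g}"
    then obtain b where b: "homeomorphic_maps X X a b"
      by (auto simp: homeomorphic_map_maps)
    then have hb: "homeomorphic_map X X b"
      using homeomorphic_map_maps homeomorphic_maps_sym by blast
    have "inv_into ?S a x = b x" if "x \<in> ?S" for x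
      using a b that
      by (intro inv_into_f_eq)
         (auto simp: Bij_def bij_betw_def homeomorphic_maps_def continuous_map_def)
    then have eq: "restrict (inv_into ?S a) ?S = restrict b ?S" by (auto simp: fun_eq_iff)
    have "inv\<^bsub>BijGroup ?S\<^esub> a = restrict b ?S"
      using a eq by (simp add: inv_BijGroup)
    moreover have "restrict b ?S \<in> Bij ?S"
      using a eq restrict_inv_into_Bij[of a ?S] by simp
    ultimately show "inv\<^bsub>BijGroup ?S\<^esub> a \<in> {g \<in> Bij ?S. homeomorphic_map X X g}"
      using restr[OF hb] by simp
  next
    fix a b
    assume ab: "a \<in> {g \<in> Bij ?S. homeomorphic_map X X g}" "b \<in> {g \<in> Bij ?S. homeomorphic_map X X g}"
    have "homeomorphic_map X X (a \<circ> b)"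
      using ab by (auto intro: homeomorphic_map_compose)
    then have "homeomorphic_map X X (restrict (a \<circ> b) ?S)" by (rule restr)
    moreover have "compose ?S a b = restrict (a \<circ> b) ?S" by (simp add: compose_def comp_def)
    ultimately show "a \<otimes>\<^bsub>BijGroup ?S\<^esub> b \<in> {g \<in> Bij ?S. homeomorphic_map X X g}"
      using ab compose_Bij[of a ?S b] by (simp add: BijGroup_def)
  qed
qed

lemma group_homeo_group: "group (homeo_group X)"
  using group.subgroup_imp_group[OF group_BijGroup subgroup_homeo]
  by (simp add: homeo_group_def)

definition space_group_pair :: "'a topology \<Rightarrow> ('a \<Rightarrow> 'a) set \<Rightarrow> bool" where
  "space_group_pair X G \<longleftrightarrow> subgroup G (homeo_group X)"

definition group_of :: "'a topology \<Rightarrow> ('a \<Rightarrow> 'a) set \<Rightarrow> ('a \<Rightarrow> 'a) monoid" where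
  "group_of X G = (homeo_group X) \<lparr>carrier := G\<rparr>"

text \<open>
  A class of space-group pairs is a polymorphic predicate.  Its instances at two independent
  carrier types are passed separately, so \<open>faithful K K\<close> with the two occurrences of \<open>K\<close> at
  types \<open>'a\<close> and \<open>'b\<close> compares arbitrary members of the class \<open>K\<close>.
\<close>

definition faithful ::
  "('a topology \<Rightarrow> ('a \<Rightarrow> 'a) set \<Rightarrow> bool) \<Rightarrow> ('b topology \<Rightarrow> ('b \<Rightarrow> 'b) set \<Rightarrow> bool) \<Rightarrow> bool"
  where
  "faithful K K' \<longleftrightarrow>
     (\<forall>X G Y H \<phi>. K X G \<longrightarrow> K' Y H \<longrightarrow> \<phi> \<in> iso (group_of X G) (group_of Y H) \<longrightarrow>
        (\<exists>\<tau> \<tau>'. homeomorphic_maps X Y \<tau> \<tau>' \<and>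
           (\<forall>g\<in>G. \<phi> g = restrict (\<tau> \<circ> g \<circ> \<tau>') (topspace Y))))"

definition somewhere_dense :: "'a topology \<Rightarrow> 'a set \<Rightarrow> bool" where
  "somewhere_dense X A \<longleftrightarrow> X interior_of (X closure_of A) \<noteq> {}"

definition locally_moving :: "'a topology \<Rightarrow> ('a \<Rightarrow> 'a) set \<Rightarrow> bool" where
  "locally_moving X G \<longleftrightarrow>
     (\<forall>U. openin X U \<and> U \<noteq> {} \<longrightarrow>
        (\<exists>g\<in>G. g \<noteq> \<one>\<^bsub>homeo_group X\<^esub> \<and> (\<forall>x\<in>topspace X - U. g x = x)))"

definition id_near :: "'a topology \<Rightarrow> ('a \<Rightarrow> 'a) \<Rightarrow> 'a \<Rightarrow> bool" where
  "id_near X g a \<longleftrightarrow> (\<exists>S. openin X S \<and> a \<in> S \<and> (\<forall>x\<in>S. g x = x))"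

definition dissects :: "'a topology \<Rightarrow> ('a \<Rightarrow> 'a) set \<Rightarrow> 'a set \<Rightarrow> 'a set \<Rightarrow> bool" where
  "dissects X G V A \<longleftrightarrow>
     A \<subseteq> topspace X \<and> infinite A \<and> openin X V \<and> V \<noteq> {} \<and>
     (\<forall>W. openin X W \<and> W \<noteq> {} \<and> W \<subseteq> V \<longrightarrow>
        (\<exists>g\<in>G. infinite {a \<in> A. g a \<in> W} \<and> infinite {a \<in> A. id_near X g a}))"

definition dissectable :: "'a topology \<Rightarrow> ('a \<Rightarrow> 'a) set \<Rightarrow> 'a set \<Rightarrow> bool" where
  "dissectable X G A \<longleftrightarrow> (\<exists>V. dissects X G V A)"

text \<open>
  \<open>discrete\<close> in the sense of having no accumulation point in the whole space, which is stronger
  than discreteness in the subspace topology.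
\<close>

definition discrete_in :: "'a topology \<Rightarrow> 'a set \<Rightarrow> bool" where
  "discrete_in X A \<longleftrightarrow> A \<subseteq> topspace X \<and> X derived_set_of A = {}"

definition flexible :: "'a topology \<Rightarrow> ('a \<Rightarrow> 'a) set \<Rightarrow> 'a set \<Rightarrow> bool" where
  "flexible X G U \<longleftrightarrow> openin X U \<and>
     (\<exists>D. D \<subseteq> U \<and> U \<subseteq> X closure_of D \<and>
        (\<forall>A. A \<subseteq> D \<and> infinite A \<and> discrete_in X A \<longrightarrow> dissectable X G A))"

definition Dset :: "'a topology \<Rightarrow> ('a \<Rightarrow> 'a) set \<Rightarrow> 'a set" where
  "Dset X G = {x \<in> topspace X. somewhere_dense X {g x | g. g \<in> G}}"

definition DF :: "'a topology \<Rightarrow> ('a \<Rightarrow> 'a) set \<Rightarrow> 'a \<Rightarrow> 'a \<Rightarrow> bool" where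
  "DF X G x y \<longleftrightarrow> somewhere_dense X {g x | g. g \<in> G \<and> id_near X g y}"

text \<open>The library's \<open>regular_space\<close> does not include the Hausdorff property.\<close>

definition K_1 :: "'a topology \<Rightarrow> ('a \<Rightarrow> 'a) set \<Rightarrow> bool" where
  "K_1 X G \<longleftrightarrow> space_group_pair X G \<and>
     regular_space X \<and> Hausdorff_space X \<and> first_countable X \<and>
     locally_moving X G \<and>
     (\<forall>x\<in>topspace X. \<forall>y\<in>topspace X. x \<noteq> y \<longrightarrow> DF X G x y) \<and>
     \<Union> {U. flexible X G U} = topspace X"

definition K_class :: "'a topology \<Rightarrow> ('a \<Rightarrow> 'a) set \<Rightarrow> bool" where
  "K_class X G \<longleftrightarrow> space_group_pair X G \<and>
     regular_space X \<and> Hausdorff_space X \<and> first_countable X \<and>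
     locally_moving X G \<and>
     \<Union> {U. flexible X G U} = topspace X \<and>
     X closure_of (Dset X G) = topspace X \<and>
     (\<forall>x\<in>Dset X G. \<forall>y\<in>Dset X G. x \<noteq> y \<longrightarrow> DF X G x y \<or> DF X G y x)"

end

theory Submission
  imports Defs
begin

text \<open>
  Since a locally moving group contains nontrivial elements supported in any open set, inclusion and
  disjointness of supports can be recognised algebraically (in the manner of the short proof of
  Rubin's theorem by Belk, Elliott and Matucci), so they are preserved by group isomorphisms.  Points
  are then encoded by sequences of nontrivial elements whose supports shrink to the point.  A sequence
  \<open>splits\<close> if it can be dissected: for all small \<open>w\<close> some \<open>g\<close> moves infinitely many
  of the supports into that of \<open>w\<close> and is trivial on parts of infinitely many of them.
  This is an algebraic property.  A convergent sequence does not split, because the required \<open>g\<close> fixes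
  the limit and moves it close to an arbitrary place.  Conversely, let all refinements of a sequence inside
  a flexible set fail to split.  Then they all accumulate somewhere, as an infinite discrete
  set would be dissectable, and two distinct accumulation points in \<open>D(X, G)\<close> would give a splitting
  by \<open>DF\<close>; so the sequence converges.  As orbits of points of \<open>D(X, G)\<close> are somewhere dense,
  a sequence converging to such a point can be translated until its image on the other side lies in
  a flexible set.  Hence isomorphisms carry convergent sequences to convergent sequences, and
  the limits define the homeomorphism.
\<close>

section \<open>Supports\<close>

text \<open>The open support; the support in the usual closed sense is its closure. Both occur,
  since inclusions are only recoverable from the group up to closure.\<close>

definition moved :: "'a topology \<Rightarrow> ('a \<Rightarrow> 'a) \<Rightarrow> 'a set" where
  "moved X g = {x \<in> topspace X. g x \<noteq> x}"

section \<open>Neighborhoods displaced by continuous maps\<close>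

lemma regular_space_closure_nbhd:
  assumes "regular_space X" "openin X U" "x \<in> U"
  obtains V where "openin X V" "x \<in> V" "X closure_of V \<subseteq> U"
proof -
  have "closedin X (topspace X - U)" "x \<in> topspace X - (topspace X - U)"
    using assms(2,3) openin_subset by blast+
  then obtain V where "openin X V" "x \<in> V" "disjnt (topspace X - U) (X closure_of V)"
    using assms(1) unfolding regular_space by meson
  moreover have "X closure_of V \<subseteq> topspace X"
    by (rule closure_of_subset_topspace)
  ultimately show thesis
    using that[of V] unfolding disjnt_def by blast
qed

lemma Hausdorff_displaced_nbhd:
  assumes "Hausdorff_space X" "continuous_map X X k" "x \<in> topspace X" "k x \<noteq> x"
  obtains V where "openin X V" "x \<in> V" "\<And>y. y \<in> V \<Longrightarrow> k y \<notin> V"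
proof -
  have "k x \<in> topspace X"
    using assms(2,3) by (simp add: continuous_map_def Pi_iff)
  then obtain A B where AB: "openin X A" "openin X B" "x \<in> A" "k x \<in> B" "disjnt A B"
    using assms unfolding Hausdorff_space_def by metis
  define V where "V = A \<inter> {y \<in> topspace X. k y \<in> B}"
  show thesis
  proof
    show "openin X V"
      unfolding V_def using AB assms(2) by (intro openin_Int openin_continuous_map_preimage)
  qed (use AB assms(3) in \<open>auto simp: V_def disjnt_iff\<close>)
qed

text \<open>Besides treating several maps at once, this version keeps \<open>V\<close> inside a
  given \<open>U\<close>; with the index set \<open>{()}\<close> it serves for a single map.\<close>

lemma Hausdorff_displaced_nbhd_finite:
  assumes "Hausdorff_space X" "finite I" "openin X U" "x \<in> U"
    "\<And>i. i \<in> I \<Longrightarrow> continuous_map X X (k i) \<and> k i x \<noteq> x"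
  obtains V where "openin X V" "x \<in> V" "V \<subseteq> U" "\<And>y i. y \<in> V \<Longrightarrow> i \<in> I \<Longrightarrow> k i y \<notin> V"
proof -
  have x: "x \<in> topspace X"
    using assms(3,4) openin_subset by blast
  have "\<exists>W. openin X W \<and> x \<in> W \<and> (\<forall>y\<in>W. k i y \<notin> W)" if "i \<in> I" for i
    using Hausdorff_displaced_nbhd[of X "k i" x] assms(1) assms(5)[OF that] x by metis
  then obtain W where W: "\<And>i. i \<in> I \<Longrightarrow> openin X (W i) \<and> x \<in> W i \<and> (\<forall>y\<in>W i. k i y \<notin> W i)"
    by metis
  show thesis
  proof
    have "openin X ((\<Inter>i\<in>I. W i) \<inter> U)" if "I \<noteq> {}"
      using that assms(2,3) W by (intro openin_Int openin_INT2) auto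
    then show "openin X (U \<inter> (\<Inter>i\<in>I. W i))"
      using assms(3) by (cases "I = {}") (auto simp: Int_commute)
  qed (use W assms(4) in auto)
qed

section \<open>The action of the group on the space\<close>

locale moving_pair =
  fixes X :: "'a topology" and G :: "('a \<Rightarrow> 'a) set"
  assumes pair: "space_group_pair X G"
    and Hausdorff: "Hausdorff_space X"
    and moving: "locally_moving X G"
begin

abbreviation M where "M \<equiv> group_of X G"

abbreviation supp where "supp \<equiv> moved X"

lemma carrier_M [simp]: "carrier M = G"
  by (simp add: group_of_def)

sublocale M: group M
  unfolding group_of_def
  using pair group.subgroup_imp_group[OF group_homeo_group] by (simp add: space_group_pair_def)

lemma one_M: "\<one>\<^bsub>M\<^esub> = \<one>\<^bsub>homeo_group X\<^esub>"
  by (simp add: group_of_def)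

lemma G_homeo: "g \<in> G \<Longrightarrow> g \<in> Bij (topspace X) \<and> homeomorphic_map X X g"
  using pair subgroup.subset[of G "homeo_group X"]
  by (auto simp: space_group_pair_def homeo_group_def)

lemma mult_apply [simp]:
  "g \<in> G \<Longrightarrow> h \<in> G \<Longrightarrow> x \<in> topspace X \<Longrightarrow> (g \<otimes>\<^bsub>M\<^esub> h) x = g (h x)"
  using G_homeo[of g] G_homeo[of h]
  by (simp add: group_of_def homeo_group_def BijGroup_def compose_def)

lemma one_apply [simp]: "x \<in> topspace X \<Longrightarrow> \<one>\<^bsub>M\<^esub> x = x"
  by (simp add: group_of_def homeo_group_def BijGroup_def)

lemma apply_closed [simp]: "g \<in> G \<Longrightarrow> x \<in> topspace X \<Longrightarrow> g x \<in> topspace X"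
  using G_homeo[of g] by (auto simp: Bij_def bij_betw_def)

lemma inv_closed' [simp]: "g \<in> G \<Longrightarrow> inv\<^bsub>M\<^esub> g \<in> G"
  using M.inv_closed by simp

lemma mult_closed' [simp]: "g \<in> G \<Longrightarrow> h \<in> G \<Longrightarrow> g \<otimes>\<^bsub>M\<^esub> h \<in> G"
  using M.m_closed by simp

lemma one_closed' [simp]: "\<one>\<^bsub>M\<^esub> \<in> G"
  using M.one_closed by simp

lemma pow_closed' [simp]: "g \<in> G \<Longrightarrow> g [^]\<^bsub>M\<^esub> (n::nat) \<in> G"
  using M.nat_pow_closed by simp

lemma apply_inv [simp]: "g \<in> G \<Longrightarrow> x \<in> topspace X \<Longrightarrow> g ((inv\<^bsub>M\<^esub> g) x) = x"
  by (metis mult_apply M.r_inv one_apply inv_closed' carrier_M)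

lemma inv_apply [simp]: "g \<in> G \<Longrightarrow> x \<in> topspace X \<Longrightarrow> (inv\<^bsub>M\<^esub> g) (g x) = x"
  by (metis mult_apply M.l_inv one_apply inv_closed' carrier_M)

lemma apply_eq_iff [simp]:
  "g \<in> G \<Longrightarrow> x \<in> topspace X \<Longrightarrow> y \<in> topspace X \<Longrightarrow> g x = g y \<longleftrightarrow> x = y"
  by (metis inv_apply)

lemma inv_fix: "g \<in> G \<Longrightarrow> x \<in> topspace X \<Longrightarrow> g x = x \<Longrightarrow> (inv\<^bsub>M\<^esub> g) x = x"
  by (metis inv_apply)

lemma funpow_closed [simp]: "g \<in> G \<Longrightarrow> x \<in> topspace X \<Longrightarrow> (g ^^ n) x \<in> topspace X"
  by (induction n) auto

lemma pow_apply [simp]: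
  "g \<in> G \<Longrightarrow> x \<in> topspace X \<Longrightarrow> (g [^]\<^bsub>M\<^esub> (n::nat)) x = (g ^^ n) x"
proof (induction n arbitrary: x)
  case (Suc n)
  then show ?case
    by (simp add: funpow_swap1)
qed simp

text \<open>Members of \<open>Bij\<close> are extensional, so their values off the space agree
  automatically.\<close>

lemma G_eqI: "g \<in> G \<Longrightarrow> h \<in> G \<Longrightarrow> (\<And>x. x \<in> topspace X \<Longrightarrow> g x = h x) \<Longrightarrow> g = h"
  using G_homeo[of g] G_homeo[of h] by (auto simp: Bij_def intro: extensionalityI)

lemma continuous_G: "g \<in> G \<Longrightarrow> continuous_map X X g"
  using G_homeo homeomorphic_imp_continuous_map by blast

lemma continuous_funpow: "g \<in> G \<Longrightarrow> continuous_map X X (g ^^ n)"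
  by (induction n) (auto intro: continuous_map_compose continuous_G simp: id_def)

section \<open>Supports, conjugation and commutation\<close>

lemma moved_subset: "supp g \<subseteq> topspace X"
  by (auto simp: moved_def)

lemma closure_of_moved: "supp g \<subseteq> X closure_of supp g"
  by (rule closure_of_subset[OF moved_subset])

lemma openin_moved: "g \<in> G \<Longrightarrow> openin X (supp g)"
proof (subst openin_subopen, clarify)
  fix x assume g: "g \<in> G" and "x \<in> supp g"
  then have x: "x \<in> topspace X" "g x \<noteq> x"
    by (auto simp: moved_def)
  obtain V where V: "openin X V" "x \<in> V" "\<And>y. y \<in> V \<Longrightarrow> g y \<notin> V"
    using Hausdorff_displaced_nbhd[OF Hausdorff continuous_G[OF g] x] by blast
  then have "V \<subseteq> supp g"
    using openin_subset by (fastforce simp: moved_def)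
  then show "\<exists>T. openin X T \<and> x \<in> T \<and> T \<subseteq> supp g"
    using V by blast
qed

lemma moved_eq_empty: "g \<in> G \<Longrightarrow> supp g = {} \<longleftrightarrow> g = \<one>\<^bsub>M\<^esub>"
  by (auto simp: moved_def intro: G_eqI)

lemma moved_image: "g \<in> G \<Longrightarrow> x \<in> supp g \<Longrightarrow> g x \<in> supp g"
  by (auto simp: moved_def)

lemma moved_conj:
  assumes "f \<in> G" "g \<in> G"
  shows "supp (g \<otimes>\<^bsub>M\<^esub> f \<otimes>\<^bsub>M\<^esub> inv\<^bsub>M\<^esub> g) = g ` supp f"
proof -
  have *: "x \<in> supp (g \<otimes>\<^bsub>M\<^esub> f \<otimes>\<^bsub>M\<^esub> inv\<^bsub>M\<^esub> g) \<longleftrightarrow> (inv\<^bsub>M\<^esub> g) x \<in> supp f"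
    if "x \<in> topspace X" for x
    using assms that apply_eq_iff[of g "f ((inv\<^bsub>M\<^esub> g) x)" "(inv\<^bsub>M\<^esub> g) x"]
    by (auto simp: moved_def)
  show ?thesis
  proof (intro equalityI subsetI)
    fix x assume "x \<in> supp (g \<otimes>\<^bsub>M\<^esub> f \<otimes>\<^bsub>M\<^esub> inv\<^bsub>M\<^esub> g)"
    then have "x \<in> topspace X" "(inv\<^bsub>M\<^esub> g) x \<in> supp f"
      using * by (auto simp: moved_def)
    then show "x \<in> g ` supp f"
      using apply_inv[of g x] assms by (metis imageI)
  next
    fix x assume "x \<in> g ` supp f"
    then obtain y where y: "y \<in> supp f" "x = g y"
      by blast
    then have "y \<in> topspace X"
      by (auto simp: moved_def)
    then show "x \<in> supp (g \<otimes>\<^bsub>M\<^esub> f \<otimes>\<^bsub>M\<^esub> inv\<^bsub>M\<^esub> g)"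
      using * y assms by simp
  qed
qed

text \<open>Every point is fixed by \<open>f\<close> or by \<open>g\<close>. If \<open>f\<close>
  moves it, its image stays in \<open>supp f\<close> and is therefore fixed by \<open>g\<close> as
  well, and symmetrically.\<close>

lemma commute_if_disjoint:
  assumes "f \<in> G" "g \<in> G" "supp f \<inter> supp g = {}"
  shows "f \<otimes>\<^bsub>M\<^esub> g = g \<otimes>\<^bsub>M\<^esub> f"
proof (rule G_eqI)
  fix x assume x: "x \<in> topspace X"
  have fixed: "b (a x) = a x" if "a \<in> G" "b \<in> G" "supp a \<inter> supp b = {}" "a x \<noteq> x" for a b
  proof -
    have "a x \<notin> supp b"
      using that x moved_image[of a x] unfolding moved_def by blast
    then show ?thesis
      using that x by (simp add: moved_def)
  qed
  have "f x = x \<or> g x = x"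
    using assms x by (auto simp: moved_def)
  then show "(f \<otimes>\<^bsub>M\<^esub> g) x = (g \<otimes>\<^bsub>M\<^esub> f) x"
    using assms x fixed[of f g] fixed[of g f] by (simp add: Int_commute) metis
qed (use assms in auto)

text \<open>For \<open>y\<close> moved by \<open>h\<close>, the point \<open>f y\<close> is outside
  \<open>V\<close> and so fixed by \<open>h\<close>. Commutation would give
  \<open>f (h y) = f y\<close>, against injectivity of \<open>f\<close>.\<close>

lemma not_commute_if_displaced:
  assumes "f \<in> G" "h \<in> G" "h \<noteq> \<one>\<^bsub>M\<^esub>" "supp h \<subseteq> V" "\<And>y. y \<in> V \<Longrightarrow> f y \<notin> V"
  shows "f \<otimes>\<^bsub>M\<^esub> h \<noteq> h \<otimes>\<^bsub>M\<^esub> f"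
proof
  assume eq: "f \<otimes>\<^bsub>M\<^esub> h = h \<otimes>\<^bsub>M\<^esub> f"
  obtain y where y: "y \<in> supp h"
    using assms moved_eq_empty by blast
  then have yX: "y \<in> topspace X" "h y \<noteq> y"
    by (auto simp: moved_def)
  have "f y \<notin> supp h"
    using assms y by blast
  then have "h (f y) = f y"
    using assms yX by (auto simp: moved_def)
  moreover have "f (h y) = h (f y)"
    using eq assms yX by (metis mult_apply)
  ultimately show False
    using assms yX by simp
qed

lemma exists_supported:
  assumes "openin X U" "U \<noteq> {}"
  obtains g where "g \<in> G" "g \<noteq> \<one>\<^bsub>M\<^esub>" "supp g \<subseteq> U"
proof -
  obtain g where "g \<in> G" "g \<noteq> \<one>\<^bsub>M\<^esub>" "\<forall>x\<in>topspace X - U. g x = x"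
    using moving assms unfolding locally_moving_def one_M by blast
  then show thesis
    using that[of g] by (auto simp: moved_def)
qed

text \<open>Induction on \<open>n\<close>, starting from a neighborhood \<open>V\<close> of
  \<open>x\<close> that the first \<open>n\<close> powers of \<open>g\<close> displace. If the next
  power fixes \<open>V\<close> pointwise, composing \<open>g\<close> with a nontrivial
  \<open>h\<close> supported in \<open>V\<close> breaks the period: an orbit starting in
  \<open>V\<close> meets \<open>supp h\<close> only at the start and on its return.\<close>

lemma exists_long_orbit:
  assumes "openin X U" "U \<noteq> {}"
  shows "\<exists>g\<in>G. \<exists>x\<in>U. supp g \<subseteq> U \<and> (\<forall>i\<in>{1..n}. (g ^^ i) x \<noteq> x)"
proof (induction n)
  case 0
  obtain g where "g \<in> G" "g \<noteq> \<one>\<^bsub>M\<^esub>" "supp g \<subseteq> U"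
    using exists_supported[OF assms] by blast
  then show ?case
    using assms by auto
next
  case (Suc n)
  then obtain g x where g: "g \<in> G" "supp g \<subseteq> U" and x: "x \<in> U"
    and orb: "\<And>i. i \<in> {1..n} \<Longrightarrow> (g ^^ i) x \<noteq> x"
    by blast
  have step: ?case if "g' \<in> G" "supp g' \<subseteq> U" "y \<in> U"
    "\<And>i. i \<in> {1..n} \<Longrightarrow> (g' ^^ i) y \<noteq> y" "(g' ^^ Suc n) y \<noteq> y" for g' y
  proof -
    have "(g' ^^ i) y \<noteq> y" if "i \<in> {1..Suc n}" for i
      using that \<open>(g' ^^ Suc n) y \<noteq> y\<close> \<open>\<And>i. i \<in> {1..n} \<Longrightarrow> (g' ^^ i) y \<noteq> y\<close>
      by (cases "i = Suc n") auto
    then show ?thesis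
      using that(1-3) by blast
  qed
  obtain V where V: "openin X V" "x \<in> V" "V \<subseteq> U"
    and disp: "\<And>y i. y \<in> V \<Longrightarrow> i \<in> {1..n} \<Longrightarrow> (g ^^ i) y \<notin> V"
    using Hausdorff_displaced_nbhd_finite[of X "{1..n}" U x "\<lambda>i. g ^^ i"]
      Hausdorff assms(1) x orb continuous_funpow[OF g(1)] by auto
  show ?case
  proof (cases "\<exists>y\<in>V. (g ^^ Suc n) y \<noteq> y")
    case True
    then obtain y where y: "y \<in> V" "(g ^^ Suc n) y \<noteq> y"
      by blast
    show ?thesis
    proof (rule step[OF g])
      show "y \<in> U"
        using y V by blast
      show "(g ^^ i) y \<noteq> y" if "i \<in> {1..n}" for i
        using disp[OF y(1) that] y(1) by metis
    qed (rule y)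
  next
    case False
    obtain h where h: "h \<in> G" "h \<noteq> \<one>\<^bsub>M\<^esub>" "supp h \<subseteq> V"
      using exists_supported[OF V(1)] V(2) by blast
    then obtain y where y: "y \<in> supp h"
      using moved_eq_empty[of h] by auto
    have yX: "y \<in> topspace X" "h y \<in> topspace X" "y \<in> V" "h y \<in> V" "h y \<noteq> y"
      using y h moved_image[OF h(1) y] by (auto simp: moved_def)
    let ?k = "g \<otimes>\<^bsub>M\<^esub> h"
    \<comment> \<open>After the first application of \<open>h\<close> the iterates avoid
      \<open>V\<close>, so \<open>h\<close> does nothing and only powers of \<open>g\<close>
      act.\<close>
    have pow: "(?k ^^ Suc i) y = (g ^^ Suc i) (h y)" if "i \<le> n" for i
      using that
    proof (induction i)
      case (Suc i)
      have "(g ^^ Suc i) (h y) \<notin> V"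
        using disp[of "h y" "Suc i"] yX Suc.prems by auto
      moreover have hX: "(g ^^ Suc i) (h y) \<in> topspace X"
        by (rule funpow_closed[OF g(1) yX(2)])
      ultimately have "h ((g ^^ Suc i) (h y)) = (g ^^ Suc i) (h y)"
        using h(3) by (auto simp: moved_def)
      moreover have "(?k ^^ Suc (Suc i)) y = ?k ((g ^^ Suc i) (h y))"
        using Suc by simp
      ultimately have "(?k ^^ Suc (Suc i)) y = g ((g ^^ Suc i) (h y))"
        using mult_apply[OF g(1) h(1) hX] by simp
      then show ?case
        by simp
    qed (use g h yX in simp)
    show ?thesis
    proof (rule step[of ?k y])
      show "supp ?k \<subseteq> U"
        using g h V(3) by (force simp: moved_def)
      show "(?k ^^ i) y \<noteq> y" if "i \<in> {1..n}" for i
      proof -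
        have "(?k ^^ i) y = (g ^^ i) (h y)"
          using pow[of "i - 1"] that by (cases i) auto
        then show ?thesis
          using disp[OF yX(4) that] yX(3) by metis
      qed
      show "(?k ^^ Suc n) y \<noteq> y"
      proof -
        have "(?k ^^ Suc n) y = h y"
          using pow[OF order_refl] False yX(4) by auto
        then show ?thesis
          using yX(5) by metis
      qed
    qed (use g h yX(3) V(3) in \<open>simp, blast\<close>)
  qed
qed

end
section \<open>Recovering supports from the group\<close>

definition commutator :: "('g, 'm) monoid_scheme \<Rightarrow> 'g \<Rightarrow> 'g \<Rightarrow> 'g" where
  "commutator M a b = a \<otimes>\<^bsub>M\<^esub> b \<otimes>\<^bsub>M\<^esub> inv\<^bsub>M\<^esub> a \<otimes>\<^bsub>M\<^esub> inv\<^bsub>M\<^esub> b"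

definition commutes :: "('g, 'm) monoid_scheme \<Rightarrow> 'g \<Rightarrow> 'g \<Rightarrow> bool" where
  "commutes M a b \<longleftrightarrow> a \<otimes>\<^bsub>M\<^esub> b = b \<otimes>\<^bsub>M\<^esub> a"

text \<open>
  Disjointness of supports implies \<open>alg_disjoint\<close>, and \<open>alg_disjoint M f g\<close> in turn forces the
  supports of \<open>f\<close> and of the twelfth power of \<open>g\<close> to be disjoint.  Twelve is the least common multiple of
  1, 2, 3, 4: a point moved by the twelfth power has at least five distinct iterates under \<open>g\<close>.
\<close>

definition alg_disjoint :: "('g, 'm) monoid_scheme \<Rightarrow> 'g \<Rightarrow> 'g \<Rightarrow> bool" where
  "alg_disjoint M f g \<longleftrightarrow>
     (\<forall>h\<in>carrier M. \<not> commutes M f h \<longrightarrow>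
        (\<exists>a\<in>carrier M. \<exists>b\<in>carrier M. commutes M a g \<and> commutes M b g \<and>
           commutator M a (commutator M b h) \<noteq> \<one>\<^bsub>M\<^esub> \<and>
           commutes M (commutator M a (commutator M b h)) g))"

text \<open>In a locally moving group this means that \<open>supp h\<close> lies in the closure of
  \<open>supp f\<close>. It tests \<open>h\<close> against the twelfth powers because these are what
  \<open>alg_disjoint\<close> controls.\<close>

definition alg_le :: "('g, 'm) monoid_scheme \<Rightarrow> 'g \<Rightarrow> 'g \<Rightarrow> bool" where
  "alg_le M h f \<longleftrightarrow>
     (\<forall>g\<in>carrier M. alg_disjoint M f g \<longrightarrow> commutes M h (g [^]\<^bsub>M\<^esub> (12::nat)))"

section \<open>Invariance of the algebraic relations under isomorphisms\<close>

context
  fixes M :: "('g, 'm) monoid_scheme" and N :: "('h, 'n) monoid_scheme" and \<phi>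
  assumes M: "group M" and N: "group N" and iso: "\<phi> \<in> iso M N"
begin

interpretation group_hom M N \<phi>
  using M N iso by (simp add: group_hom_def group_hom_axioms_def iso_def)

lemma iso_commutes:
  assumes "a \<in> carrier M" "b \<in> carrier M"
  shows "commutes N (\<phi> a) (\<phi> b) \<longleftrightarrow> commutes M a b"
proof -
  have "inj_on \<phi> (carrier M)"
    using iso by (simp add: Group.iso_iff)
  then show ?thesis
    using assms unfolding commutes_def by (simp add: inj_on_eq_iff flip: hom_mult)
qed

lemma iso_commutator:
  "a \<in> carrier M \<Longrightarrow> b \<in> carrier M \<Longrightarrow> commutator N (\<phi> a) (\<phi> b) = \<phi> (commutator M a b)"
  by (simp add: commutator_def)

lemma iso_eq_one: "a \<in> carrier M \<Longrightarrow> \<phi> a = \<one>\<^bsub>N\<^esub> \<longleftrightarrow> a = \<one>\<^bsub>M\<^esub>"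
  using iso one_closed hom_one unfolding Group.iso_iff by (metis G.one_closed inj_on_eq_iff)

text \<open>\<open>alg_disjoint\<close> is a first-order formula in the group operations, and
  \<open>carrier N\<close> is the image of \<open>carrier M\<close>, so each quantifier can be
  pulled back along \<open>\<phi>\<close>.\<close>

lemma iso_alg_disjoint:
  assumes "f \<in> carrier M" "g \<in> carrier M"
  shows "alg_disjoint N (\<phi> f) (\<phi> g) \<longleftrightarrow> alg_disjoint M f g"
proof -
  have im: "carrier N = \<phi> ` carrier M"
    using iso by (simp add: Group.iso_iff)
  have cl: "commutator M a b \<in> carrier M" if "a \<in> carrier M" "b \<in> carrier M" for a b
    using that by (simp add: commutator_def)
  show ?thesis
    unfolding alg_disjoint_def im ball_simps bex_simps
    using assms
    by (intro ball_cong bex_cong imp_cong conj_cong refl arg_cong[of _ _ Not])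
      (simp_all add: iso_commutes iso_commutator iso_eq_one cl)
qed

lemma iso_alg_le:
  assumes "h \<in> carrier M" "f \<in> carrier M"
  shows "alg_le N (\<phi> h) (\<phi> f) \<longleftrightarrow> alg_le M h f"
proof -
  have im: "carrier N = \<phi> ` carrier M"
    using iso by (simp add: Group.iso_iff)
  show ?thesis
    unfolding alg_le_def im ball_simps using assms
    by (intro ball_cong imp_cong refl) (simp_all add: iso_alg_disjoint iso_commutes flip: hom_nat_pow)
qed

end

section \<open>Algebraic characterisations of disjointness and inclusion of supports\<close>

context moving_pair
begin

lemma commutes_iff:
  "a \<in> G \<Longrightarrow> b \<in> G \<Longrightarrow> commutes M a b \<longleftrightarrow> (\<forall>x\<in>topspace X. a (b x) = b (a x))"
  unfolding commutes_def
  using mult_apply by (metis G_eqI mult_closed')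

lemma commutator_closed: "a \<in> G \<Longrightarrow> b \<in> G \<Longrightarrow> commutator M a b \<in> G"
  by (simp add: commutator_def)

lemma commutator_apply:
  "a \<in> G \<Longrightarrow> b \<in> G \<Longrightarrow> x \<in> topspace X \<Longrightarrow>
    commutator M a b x = a (b ((inv\<^bsub>M\<^esub> a) ((inv\<^bsub>M\<^esub> b) x)))"
  by (simp add: commutator_def)

lemma commutator_eq_one_iff:
  "a \<in> G \<Longrightarrow> b \<in> G \<Longrightarrow> commutator M a b = \<one>\<^bsub>M\<^esub> \<longleftrightarrow> commutes M a b"
  unfolding commutator_def commutes_def
  by (metis M.inv_closed M.inv_equality M.inv_mult_group M.m_assoc M.m_closed M.r_inv M.inv_inv carrier_M)

text \<open>
  If \<open>a\<close> and \<open>b\<close> live inside a set \<open>V\<close> that \<open>h\<close> displaces, then \<open>[b, h]\<close> agrees with \<open>b\<close> on \<open>V\<close>, so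
  \<open>[a, [b, h]] = [a, b]\<close>.
\<close>

lemma alg_disjoint_if_disjoint:
  assumes f: "f \<in> G" and g: "g \<in> G" and disj: "supp f \<inter> supp g = {}"
  shows "alg_disjoint M f g"
  unfolding alg_disjoint_def
proof (intro ballI impI)
  fix h assume "h \<in> carrier M" and nc: "\<not> commutes M f h"
  then have h: "h \<in> G"
    by simp
  have "supp f \<inter> supp h \<noteq> {}"
    using nc commute_if_disjoint[OF f h] by (auto simp: commutes_def)
  then obtain x where x: "x \<in> topspace X" "x \<in> supp f" "h x \<noteq> x"
    by (auto simp: moved_def)
  obtain V where V: "openin X V" "x \<in> V" "V \<subseteq> supp f" "\<And>y. y \<in> V \<Longrightarrow> h y \<notin> V"
    using Hausdorff_displaced_nbhd_finite[of X "{()}" "supp f" x "\<lambda>_. h"]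
      Hausdorff openin_moved[OF f] x continuous_G[OF h] by auto
  have VX: "V \<subseteq> topspace X"
    using V(1) openin_subset by blast
  obtain a where a: "a \<in> G" "a \<noteq> \<one>\<^bsub>M\<^esub>" "supp a \<subseteq> V"
    using exists_supported[OF V(1)] V(2) by blast
  then obtain z where "z \<in> supp a"
    using moved_eq_empty[OF a(1)] by auto
  then have z: "z \<in> topspace X" "a z \<noteq> z" "z \<in> supp a"
    by (auto simp: moved_def)
  \<comment> \<open>The displacement argument one level down: \<open>b\<close> supported in a set
    displaced by \<open>a\<close> cannot commute with \<open>a\<close>, so \<open>[a, b]\<close> is
    nontrivial.\<close>
  obtain U where U: "openin X U" "z \<in> U" "U \<subseteq> supp a" "\<And>y. y \<in> U \<Longrightarrow> a y \<notin> U"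
    using Hausdorff_displaced_nbhd_finite[of X "{()}" "supp a" z "\<lambda>_. a"]
      Hausdorff openin_moved[OF a(1)] z continuous_G[OF a(1)] by auto
  obtain b where b: "b \<in> G" "b \<noteq> \<one>\<^bsub>M\<^esub>" "supp b \<subseteq> U"
    using exists_supported[OF U(1)] U(2) by blast
  have ab: "\<not> commutes M a b"
    using not_commute_if_displaced[OF a(1) b U(4)] by (simp add: commutes_def)
  have bV: "supp b \<subseteq> V"
    using b U a by blast
  have comm: "commutes M c g" if "c \<in> G" "supp c \<subseteq> V" for c
    using commute_if_disjoint[OF that(1) g] that V(3) disj by (auto simp: commutes_def)
  have eq: "commutator M a (commutator M b h) = commutator M a b"
  proof (rule G_eqI)
    fix y assume y: "y \<in> topspace X"
    let ?c = "commutator M b h"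
    have c: "?c \<in> G"
      using b h by (simp add: commutator_closed)
    have fixV: "k u = u" if "supp k \<subseteq> V" "u \<in> topspace X" "u \<notin> V" for k u
      using that by (auto simp: moved_def)
    have stay: "k u \<in> V" if k: "k \<in> G" "supp k \<subseteq> V" and u: "u \<in> V" for k u
    proof (cases "k u = u")
      case False
      then have "u \<in> supp k"
        using u VX by (auto simp: moved_def)
      then show ?thesis
        using moved_image[OF k(1)] k(2) by blast
    qed (use u in simp)
    have supp_inv: "supp (inv\<^bsub>M\<^esub> k) \<subseteq> V" if k: "k \<in> G" "supp k \<subseteq> V" for k
      using k inv_fix[OF k(1)] by (fastforce simp: moved_def)
    have c_eq: "?c u = b u" if u: "u \<in> V" for u
    proof -
      have uX: "u \<in> topspace X" "(inv\<^bsub>M\<^esub> h) u \<in> topspace X"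
        using u VX h by auto
      have "(inv\<^bsub>M\<^esub> h) u \<notin> V"
        using V(4)[of "(inv\<^bsub>M\<^esub> h) u"] u uX h by auto
      then have "(inv\<^bsub>M\<^esub> b) ((inv\<^bsub>M\<^esub> h) u) = (inv\<^bsub>M\<^esub> h) u"
        by (intro fixV supp_inv b bV uX)
      then show ?thesis
        using commutator_apply[OF b(1) h uX(1)] uX h by simp
    qed
    have inv_c_eq: "(inv\<^bsub>M\<^esub> ?c) u = (inv\<^bsub>M\<^esub> b) u" if u: "u \<in> V" for u
    proof -
      have w: "(inv\<^bsub>M\<^esub> b) u \<in> V"
        by (rule stay[OF inv_closed'[OF b(1)] supp_inv[OF b(1) bV] u])
      have "?c ((inv\<^bsub>M\<^esub> b) u) = u"
        using c_eq[OF w] apply_inv[OF b(1) subsetD[OF VX u]] by (rule trans)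
      then show ?thesis
        using inv_apply[OF c subsetD[OF VX w]] by metis
    qed
    show "commutator M a ?c y = commutator M a b y"
    proof (cases "y \<in> V")
      case True
      have "(inv\<^bsub>M\<^esub> a) ((inv\<^bsub>M\<^esub> b) y) \<in> V"
        by (rule stay[OF inv_closed'[OF a(1)] supp_inv[OF a(1,3)]
            stay[OF inv_closed'[OF b(1)] supp_inv[OF b(1) bV] True]])
      then show ?thesis
        using True a(1) b(1) c y by (simp add: commutator_apply inv_c_eq c_eq)
    next
      case False
      let ?u = "(inv\<^bsub>M\<^esub> ?c) y"
      have u: "?u \<in> topspace X" "?c ?u = y"
        using y c by auto
      \<comment> \<open>Like \<open>b\<close>, the commutator \<open>?c\<close> maps
        \<open>V\<close> into itself, so a point outside \<open>V\<close> has its preimage under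
        \<open>?c\<close> outside \<open>V\<close> too.\<close>
      have "?u \<notin> V"
      proof
        assume uV: "?u \<in> V"
        then have "y = b ?u"
          using c_eq u by metis
        then show False
          using stay[OF b(1) bV uV] False by simp
      qed
      then have "(inv\<^bsub>M\<^esub> a) ?u = ?u"
        by (intro fixV supp_inv a u)
      moreover have "a y = y" "(inv\<^bsub>M\<^esub> a) y = y" "b y = y" "(inv\<^bsub>M\<^esub> b) y = y"
        using fixV[OF _ y False] supp_inv a(1,3) b(1) bV by blast+
      ultimately show ?thesis
        using a(1) b(1) c y u by (simp add: commutator_apply)
    qed
  qed (use a b h in \<open>simp_all add: commutator_closed\<close>)
  have "supp (commutator M a b) \<subseteq> V"
  proof
    fix y assume "y \<in> supp (commutator M a b)"
    then have y: "y \<in> topspace X" "commutator M a b y \<noteq> y"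
      by (auto simp: moved_def)
    show "y \<in> V"
    proof (rule ccontr)
      assume "y \<notin> V"
      then have "a y = y" "b y = y"
        using a(3) bV y by (auto simp: moved_def)
      then show False
        using y a(1) b(1) by (simp add: commutator_apply inv_fix)
    qed
  qed
  then show "\<exists>a\<in>carrier M. \<exists>b\<in>carrier M. commutes M a g \<and> commutes M b g \<and>
      commutator M a (commutator M b h) \<noteq> \<one>\<^bsub>M\<^esub> \<and>
      commutes M (commutator M a (commutator M b h)) g"
    using a b bV ab comm commutator_closed[OF a(1) b(1)]
    by (intro bexI[of _ a] bexI[of _ b]) (auto simp: eq commutator_eq_one_iff)
qed


lemma commutes_funpow:
  assumes "a \<in> G" "g \<in> G" "commutes M a g" "x \<in> topspace X"
  shows "a ((g ^^ i) x) = (g ^^ i) (a x)"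
  using assms(4)
proof (induction i)
  case (Suc i)
  then show ?case
    using assms(1-3) funpow_closed[OF assms(2) Suc.prems, of i] by (simp add: commutes_iff)
qed simp

lemma commutes_inv:
  assumes "a \<in> G" "g \<in> G" "commutes M a g"
  shows "commutes M (inv\<^bsub>M\<^esub> a) g"
  using assms by (simp add: commutes_def)
    (metis M.inv_solve_left' M.inv_solve_right' M.m_assoc carrier_M inv_closed' mult_closed')

text \<open>\<open>[b, h]\<close> is the product of \<open>b h b^-1\<close> and \<open>h^-1\<close>,
  so it moves only points of \<open>supp h\<close> and of its translate by \<open>b\<close>. The
  same argument for \<open>a\<close> and \<open>[b, h]\<close> leaves four translates of
  \<open>supp h\<close>.\<close>

lemma moved_double_commutator:
  assumes "a \<in> G" "b \<in> G" "h \<in> G"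
    and x: "x \<in> supp (commutator M a (commutator M b h))"
  shows "\<exists>e\<in>{\<one>\<^bsub>M\<^esub>, b, a, a \<otimes>\<^bsub>M\<^esub> b}. (inv\<^bsub>M\<^esub> e) x \<in> supp h"
proof (rule ccontr)
  assume contra: "\<not> ?thesis"
  let ?c = "commutator M b h"
  have xX: "x \<in> topspace X"
    using x by (simp add: moved_def)
  have c_fix: "?c u = u" if u: "u \<in> topspace X" "u \<notin> supp h" "(inv\<^bsub>M\<^esub> b) u \<notin> supp h" for u
  proof -
    have "h u = u" "h ((inv\<^bsub>M\<^esub> b) u) = (inv\<^bsub>M\<^esub> b) u"
      using u assms by (auto simp: moved_def)
    then show ?thesis
      using u assms by (simp add: commutator_apply inv_fix)
  qed
  have c: "?c \<in> G"
    using assms by (simp add: commutator_closed)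
  have "inv\<^bsub>M\<^esub> (a \<otimes>\<^bsub>M\<^esub> b) = inv\<^bsub>M\<^esub> b \<otimes>\<^bsub>M\<^esub> inv\<^bsub>M\<^esub> a"
    using assms by (simp add: M.inv_mult_group)
  then have "x \<notin> supp h" "(inv\<^bsub>M\<^esub> b) x \<notin> supp h" "(inv\<^bsub>M\<^esub> a) x \<notin> supp h"
    "(inv\<^bsub>M\<^esub> b) ((inv\<^bsub>M\<^esub> a) x) \<notin> supp h"
    using contra assms xX by auto
  then have "?c x = x" "?c ((inv\<^bsub>M\<^esub> a) x) = (inv\<^bsub>M\<^esub> a) x"
    using xX assms by (auto intro!: c_fix)
  then have "commutator M a ?c x = x"
    using assms c xX by (simp add: commutator_apply inv_fix)
  then show False
    using x by (simp add: moved_def)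
qed

text \<open>A pigeonhole argument. Near a point moved by \<open>f\<close> and by the twelfth power
  of \<open>g\<close>, take \<open>V\<close> displaced by \<open>f\<close> and by the first four
  powers of \<open>g\<close>, and \<open>h\<close> supported in \<open>V\<close>. The resulting
  double commutator commutes with \<open>g\<close>, so it moves five iterates of some
  \<open>z\<close>; these lie in four translates of \<open>V\<close> by elements commuting with
  \<open>g\<close>. Two iterates in one translate give a point of \<open>V\<close> that a small
  power of \<open>g\<close> returns to \<open>V\<close>.\<close>

lemma disjoint_if_alg_disjoint:
  assumes f: "f \<in> G" and g: "g \<in> G" and ad: "alg_disjoint M f g"
  shows "supp f \<inter> supp (g [^]\<^bsub>M\<^esub> (12::nat)) = {}"
proof (rule ccontr)
  assume "supp f \<inter> supp (g [^]\<^bsub>M\<^esub> (12::nat)) \<noteq> {}"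
  then obtain x where x: "x \<in> topspace X" "f x \<noteq> x" "(g ^^ 12) x \<noteq> x"
    using g by (auto simp: moved_def)
  have "(g ^^ i) x \<noteq> x" if "i \<in> {1..4}" for i
  proof
    assume i: "(g ^^ i) x = x"
    have "i = 1 \<or> i = 2 \<or> i = 3 \<or> i = 4"
      using that by auto
    then have "i dvd 12"
      by auto
    then obtain k where k: "12 = i * k" ..
    have "((g ^^ i) ^^ k) x = x"
      using i by (induction k) auto
    then show False
      using x(3) k by (simp add: funpow_mult mult.commute)
  qed
  \<comment> \<open>Index 0 stands for \<open>f\<close>, so that one neighborhood displaced by
    \<open>f\<close> and by four powers of \<open>g\<close> is obtained at once.\<close>
  moreover define k where "k i = (if i = 0 then f else g ^^ i)" for i :: nat
  ultimately have kc: "continuous_map X X (k i) \<and> k i x \<noteq> x" if "i \<in> {0..4}" for i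
    using that x continuous_G[OF f] continuous_funpow[OF g, of i] by (cases "i = 0") auto
  obtain V where V: "openin X V" "x \<in> V"
    and disp: "\<And>y i. y \<in> V \<Longrightarrow> i \<in> {0..4} \<Longrightarrow> k i y \<notin> V"
    by (rule Hausdorff_displaced_nbhd_finite[where I = "{0..4}" and k = k,
          OF Hausdorff finite_atLeastAtMost openin_topspace x(1) kc]) (assumption, rule that)
  have fV: "f y \<notin> V" if "y \<in> V" for y
    using disp[OF that, of 0] by (simp add: k_def)
  have gV: "(g ^^ i) y \<notin> V" if "y \<in> V" "i \<in> {1..4}" for y i
    using disp[OF that(1), of i] that(2) by (simp add: k_def)
  obtain h where h: "h \<in> G" "h \<noteq> \<one>\<^bsub>M\<^esub>" "supp h \<subseteq> V"
    using exists_supported[OF V(1)] V(2) by blast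
  have "\<not> commutes M f h"
    using not_commute_if_displaced[OF f h fV] by (simp add: commutes_def)
  then obtain a b where ab: "a \<in> G" "b \<in> G" "commutes M a g" "commutes M b g"
    and k: "commutator M a (commutator M b h) \<noteq> \<one>\<^bsub>M\<^esub>"
      "commutes M (commutator M a (commutator M b h)) g"
    using ad h(1) unfolding alg_disjoint_def by auto
  let ?k = "commutator M a (commutator M b h)"
  have kG: "?k \<in> G"
    using ab h by (simp add: commutator_closed)
  then obtain z where z: "z \<in> supp ?k"
    using k(1) moved_eq_empty by blast
  have zX: "z \<in> topspace X" "?k z \<noteq> z"
    using z by (auto simp: moved_def)
  let ?E = "{\<one>\<^bsub>M\<^esub>, b, a, a \<otimes>\<^bsub>M\<^esub> b}"
  \<comment> \<open>As \<open>?k\<close> commutes with \<open>g\<close>, its support is invariant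
    under \<open>g\<close> and contains all iterates of \<open>z\<close>.\<close>
  have "\<exists>e\<in>?E. (inv\<^bsub>M\<^esub> e) ((g ^^ i) z) \<in> V" for i
  proof -
    have "?k ((g ^^ i) z) = (g ^^ i) (?k z)"
      by (rule commutes_funpow[OF kG g k(2) zX(1)])
    moreover have "inj_on (g ^^ i) (topspace X)"
      using g by (metis (no_types, lifting) inj_onI pow_apply apply_eq_iff pow_closed')
    ultimately have "?k ((g ^^ i) z) \<noteq> (g ^^ i) z"
      using zX kG by (auto dest: inj_onD)
    then have "(g ^^ i) z \<in> supp ?k"
      using g zX by (simp add: moved_def)
    then show ?thesis
      using moved_double_commutator[OF ab(1,2) h(1)] h(3) by blast
  qed
  then obtain e where e: "\<And>i. e i \<in> ?E" "\<And>i. (inv\<^bsub>M\<^esub> (e i)) ((g ^^ i) z) \<in> V"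
    by metis
  \<comment> \<open>Five exponents against at most four translating elements.\<close>
  have "card ?E < card {0..4::nat}"
    using card_insert_le_m1 by (auto simp: card_insert_if)
  moreover have "e ` {0..4} \<subseteq> ?E"
    using e(1) by blast
  ultimately have "\<not> inj_on e {0..4}"
    using card_inj_on_le[of e "{0..4}" ?E] by auto
  then obtain i j where ij: "i < j" "j \<le> 4" "e i = e j"
    unfolding inj_on_def by (metis atLeastAtMost_iff linorder_neqE_nat)
  have eG: "e i \<in> G"
    using e(1)[of i] ab by auto
  have "commutes M (a \<otimes>\<^bsub>M\<^esub> b) g"
    using ab g by (simp add: commutes_iff)
  moreover have "commutes M \<one>\<^bsub>M\<^esub> g"
    using g by (simp add: commutes_def)
  ultimately have "commutes M (e i) g"
    using e(1)[of i] ab by auto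
  then have comm: "commutes M (inv\<^bsub>M\<^esub> (e i)) g"
    using commutes_inv eG g by blast
  define u where "u = (inv\<^bsub>M\<^esub> (e i)) ((g ^^ i) z)"
  have "(g ^^ j) z = (g ^^ (j - i)) ((g ^^ i) z)"
    using ij by (simp flip: comp_apply[of "g ^^ _"] funpow_add)
  then have "(inv\<^bsub>M\<^esub> (e i)) ((g ^^ j) z) = (g ^^ (j - i)) u"
    unfolding u_def using commutes_funpow[OF _ g comm] eG zX g by simp
  then have "(g ^^ (j - i)) u \<in> V" "u \<in> V"
    using e(2)[of i] e(2)[of j] ij by (simp_all add: u_def)
  moreover have "j - i \<in> {1..4}"
    using ij(1,2) by simp arith
  ultimately show False
    using gV[of u "j - i"] by blast
qed

text \<open>If the inclusion holds and \<open>g\<close> is algebraically disjoint from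
  \<open>f\<close>, the support of the twelfth power of \<open>g\<close> is open and misses
  \<open>supp f\<close>, hence also its closure and \<open>supp h\<close>. If it fails, there is
  room outside that closure for some \<open>g\<close> whose twelfth power is nontrivial and lies in
  a set displaced by \<open>h\<close>, hence does not commute with \<open>h\<close>.\<close>

lemma alg_le_iff:
  assumes h: "h \<in> G" and f: "f \<in> G"
  shows "alg_le M h f \<longleftrightarrow> supp h \<subseteq> X closure_of supp f"
proof
  assume sub: "supp h \<subseteq> X closure_of supp f"
  show "alg_le M h f"
    unfolding alg_le_def
  proof (intro ballI impI)
    fix g assume "g \<in> carrier M" and ad: "alg_disjoint M f g"
    then have g: "g \<in> G"
      by simp
    have "supp (g [^]\<^bsub>M\<^esub> (12::nat)) \<inter> X closure_of supp f = {}"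
      using openin_Int_closure_of_eq_empty[OF openin_moved[of "g [^]\<^bsub>M\<^esub> (12::nat)"]]
        disjoint_if_alg_disjoint[OF f g ad] g by (auto simp: Int_commute)
    then show "commutes M h (g [^]\<^bsub>M\<^esub> (12::nat))"
      using commute_if_disjoint[OF h, of "g [^]\<^bsub>M\<^esub> (12::nat)"] g sub
      by (auto simp: commutes_def)
  qed
next
  assume le: "alg_le M h f"
  show "supp h \<subseteq> X closure_of supp f"
  proof (rule ccontr)
    assume "\<not> ?thesis"
    then obtain x where x: "x \<in> supp h" "x \<notin> X closure_of supp f"
      by blast
    let ?O = "supp h - X closure_of supp f"
    have O: "openin X ?O"
      using openin_moved[OF h] by (intro openin_diff) auto
    obtain V where V: "openin X V" "x \<in> V" "V \<subseteq> ?O" "\<And>y. y \<in> V \<Longrightarrow> h y \<notin> V"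
      using Hausdorff_displaced_nbhd_finite[OF Hausdorff, of "{()}" ?O x "\<lambda>_. h"] O x
        continuous_G[OF h] by (auto simp: moved_def)
    \<comment> \<open>An orbit of this length ensures that the twelfth power still moves
      \<open>u\<close>.\<close>
    obtain g u where g: "g \<in> G" "supp g \<subseteq> V" "u \<in> V" "\<forall>i\<in>{1..12}. (g ^^ i) u \<noteq> u"
      using exists_long_orbit[OF V(1)] V(2) by blast
    let ?g = "g [^]\<^bsub>M\<^esub> (12::nat)"
    have uX: "u \<in> topspace X"
      using g(3) V(1) openin_subset by blast
    have "u \<in> supp ?g"
      using g uX by (simp add: moved_def)
    then have ne: "?g \<noteq> \<one>\<^bsub>M\<^esub>"
      by (auto simp: moved_def)
    have "supp ?g \<subseteq> supp g"
    proof
      fix y assume y: "y \<in> supp ?g"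
      show "y \<in> supp g"
      proof (rule ccontr)
        assume "y \<notin> supp g"
        then have "g y = y" "y \<in> topspace X"
          using y by (auto simp: moved_def)
        then have "(g ^^ n) y = y" for n
          by (induction n) auto
        then show False
          using y pow_apply[OF g(1) \<open>y \<in> topspace X\<close>, of 12] by (simp add: moved_def)
      qed
    qed
    then have "h \<otimes>\<^bsub>M\<^esub> ?g \<noteq> ?g \<otimes>\<^bsub>M\<^esub> h"
      using not_commute_if_displaced[OF h _ ne _ V(4)] g by auto
    moreover have "supp f \<inter> supp g = {}"
      using g(2) V(3) closure_of_moved by blast
    then have "alg_disjoint M f g"
      by (rule alg_disjoint_if_disjoint[OF f g(1)])
    ultimately show False
      using le g(1) by (auto simp: alg_le_def commutes_def)
  qed
qed

text \<open>The closures of disjoint open sets have no nonempty open set in common, whereas a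
  nonempty intersection of supports contains the support of a nontrivial element. This reduces
  disjointness to \<open>alg_le\<close>, which isomorphisms preserve.\<close>

lemma disjoint_iff_alg_le:
  assumes "f \<in> G" "g \<in> G"
  shows "supp f \<inter> supp g = {} \<longleftrightarrow> (\<forall>m\<in>G. alg_le M m f \<and> alg_le M m g \<longrightarrow> m = \<one>\<^bsub>M\<^esub>)"
proof (intro iffI ballI impI)
  fix m assume disj: "supp f \<inter> supp g = {}" and m: "m \<in> G" "alg_le M m f \<and> alg_le M m g"
  have "supp g \<inter> X closure_of supp f = {}"
    using disj openin_Int_closure_of_eq_empty[OF openin_moved[OF assms(2)]] by blast
  then have "supp m \<inter> supp g = {}"
    using m assms by (auto simp: alg_le_iff)
  then have "supp m \<inter> X closure_of supp g = {}"
    using openin_Int_closure_of_eq_empty[OF openin_moved[OF m(1)]] by blast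
  then have "supp m = {}"
    using m assms by (auto simp: alg_le_iff)
  then show "m = \<one>\<^bsub>M\<^esub>"
    using m(1) moved_eq_empty by simp
next
  assume *: "\<forall>m\<in>G. alg_le M m f \<and> alg_le M m g \<longrightarrow> m = \<one>\<^bsub>M\<^esub>"
  show "supp f \<inter> supp g = {}"
  proof (rule ccontr)
    assume "supp f \<inter> supp g \<noteq> {}"
    then obtain m where m: "m \<in> G" "m \<noteq> \<one>\<^bsub>M\<^esub>" "supp m \<subseteq> supp f \<inter> supp g"
      using exists_supported[OF openin_Int[OF openin_moved[OF assms(1)] openin_moved[OF assms(2)]]]
      by blast
    then have "supp m \<subseteq> X closure_of supp f" "supp m \<subseteq> X closure_of supp g"
      using closure_of_moved by blast+
    then show False
      using * m assms by (simp add: alg_le_iff)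
  qed
qed

end
section \<open>Sequences of group elements with shrinking supports\<close>

text \<open>The supports shrink to \<open>x\<close> but need not contain it.\<close>

definition tends :: "'a topology \<Rightarrow> (nat \<Rightarrow> 'a \<Rightarrow> 'a) \<Rightarrow> 'a \<Rightarrow> bool" where
  "tends X u x \<longleftrightarrow> x \<in> topspace X \<and>
     (\<forall>N. openin X N \<and> x \<in> N \<longrightarrow> (\<forall>\<^sub>F n in sequentially. moved X (u n) \<subseteq> N))"

text \<open>A generalised subsequence: \<open>r\<close> need not be increasing, so two refinements
  can be interlaced. The closure appears because inclusion of a support in a closed support is what
  isomorphisms preserve.\<close>

definition refines :: "'a topology \<Rightarrow> (nat \<Rightarrow> 'a \<Rightarrow> 'a) \<Rightarrow> (nat \<Rightarrow> 'a \<Rightarrow> 'a) \<Rightarrow> bool" where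
  "refines X u v \<longleftrightarrow>
     (\<exists>r. filterlim r sequentially sequentially \<and>
        (\<forall>n. moved X (u n) \<subseteq> X closure_of moved X (v (r n))))"

definition interlace :: "(nat \<Rightarrow> 'b) \<Rightarrow> (nat \<Rightarrow> 'b) \<Rightarrow> nat \<Rightarrow> 'b" where
  "interlace u v n = (if even n then u (n div 2) else v (n div 2))"

lemma eventually_interlace:
  assumes "\<forall>\<^sub>F n in sequentially. P (u n)" "\<forall>\<^sub>F n in sequentially. P (v n)"
  shows "\<forall>\<^sub>F n in sequentially. P (interlace u v n)"
proof -
  obtain m k where "\<And>n. n \<ge> m \<Longrightarrow> P (u n)" "\<And>n. n \<ge> k \<Longrightarrow> P (v n)"
    using assms unfolding eventually_sequentially by blast
  then have "P (interlace u v n)" if "n \<ge> 2 * m + 2 * k" for n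
    using that by (auto simp: interlace_def)
  then show ?thesis
    unfolding eventually_sequentially by blast
qed

lemma frequently_interlace:
  assumes "(\<exists>\<^sub>F n in sequentially. P (u n)) \<or> (\<exists>\<^sub>F n in sequentially. P (v n))"
  shows "\<exists>\<^sub>F n in sequentially. P (interlace u v n)"
proof -
  have "P (interlace u v (2 * n)) \<longleftrightarrow> P (u n)" "P (interlace u v (2 * n + 1)) \<longleftrightarrow> P (v n)" for n
    by (simp_all add: interlace_def)
  moreover have "\<exists>n\<ge>m. P (u n) \<or> P (v n)" for m
    using assms unfolding frequently_sequentially by blast
  ultimately have "\<exists>n\<ge>m. P (interlace u v (2 * n)) \<or> P (interlace u v (2 * n + 1))" for m
    by blast
  then have "\<exists>n\<ge>m. P (interlace u v n)" for m
    by (metis add.commute le_add2 le_trans mult_2 trans_le_add2)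
  then show ?thesis
    unfolding frequently_sequentially by blast
qed

lemma tends_interlace: "tends X u x \<Longrightarrow> tends X v x \<Longrightarrow> tends X (interlace u v) x"
  using eventually_interlace[where P = "\<lambda>g. moved X g \<subseteq> N" for N]
  unfolding tends_def by blast

lemma refines_interlace:
  assumes "refines X u w" "refines X v w"
  shows "refines X (interlace u v) w"
proof -
  obtain r s where r: "filterlim r sequentially sequentially"
      "\<And>n. moved X (u n) \<subseteq> X closure_of moved X (w (r n))"
    and s: "filterlim s sequentially sequentially"
      "\<And>n. moved X (v n) \<subseteq> X closure_of moved X (w (s n))"
    using assms unfolding refines_def by blast
  have "filterlim (interlace r s) sequentially sequentially"
    unfolding filterlim_iff
  proof (intro allI impI)
    fix P :: "nat \<Rightarrow> bool" assume "eventually P sequentially"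
    then show "\<forall>\<^sub>F n in sequentially. P (interlace r s n)"
      using r(1) s(1) unfolding filterlim_iff by (intro eventually_interlace[of P]) auto
  qed
  moreover have "moved X (interlace u v n) \<subseteq> X closure_of moved X (w (interlace r s n))" for n
    using r(2) s(2) by (simp add: interlace_def)
  ultimately show ?thesis
    unfolding refines_def by blast
qed

lemma refines_trans:
  assumes "refines X u v" "refines X v w"
  shows "refines X u w"
proof -
  obtain r s where r: "filterlim r sequentially sequentially"
      "\<And>n. moved X (u n) \<subseteq> X closure_of moved X (v (r n))"
    and s: "filterlim s sequentially sequentially"
      "\<And>n. moved X (v n) \<subseteq> X closure_of moved X (w (s n))"
    using assms unfolding refines_def by blast
  have "X closure_of moved X (v m) \<subseteq> X closure_of moved X (w (s m))" for m
    using s(2) by (intro closure_of_minimal) auto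
  then have "moved X (u n) \<subseteq> X closure_of moved X (w (s (r n)))" for n
    using r(2) by blast
  moreover have "filterlim (\<lambda>n. s (r n)) sequentially sequentially"
    by (rule filterlim_compose[OF s(1) r(1)])
  ultimately show ?thesis
    unfolding refines_def by blast
qed

text \<open>Regularity absorbs the closure in \<open>refines\<close>: once a support of
  \<open>v\<close> lies in \<open>V\<close>, its closure lies in the closure of \<open>V\<close> and
  hence in \<open>N\<close>.\<close>

lemma tends_refines:
  assumes "regular_space X" "tends X v x" "refines X u v"
  shows "tends X u x"
  unfolding tends_def
proof (intro conjI allI impI)
  show "x \<in> topspace X"
    using assms(2) by (simp add: tends_def)
  obtain r where r: "filterlim r sequentially sequentially"
    "\<And>n. moved X (u n) \<subseteq> X closure_of moved X (v (r n))"
    using assms(3) unfolding refines_def by blast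
  fix N assume "openin X N \<and> x \<in> N"
  then obtain V where V: "openin X V" "x \<in> V" "X closure_of V \<subseteq> N"
    using regular_space_closure_nbhd[OF assms(1)] by metis
  then have "\<forall>\<^sub>F n in sequentially. moved X (v n) \<subseteq> V"
    using assms(2) by (simp add: tends_def)
  then have "\<forall>\<^sub>F n in sequentially. moved X (v (r n)) \<subseteq> V"
    by (rule eventually_compose_filterlim[OF _ r(1)])
  then show "\<forall>\<^sub>F n in sequentially. moved X (u n) \<subseteq> N"
  proof (rule eventually_mono)
    fix n assume "moved X (v (r n)) \<subseteq> V"
    then have "X closure_of moved X (v (r n)) \<subseteq> X closure_of V"
      by (rule closure_of_mono)
    then show "moved X (u n) \<subseteq> N"
      using r(2)[of n] V(3) by order
  qed
qed

lemma tends_shift: "tends X (\<lambda>n. u (n + k)) x \<longleftrightarrow> tends X u x"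
  unfolding tends_def by (simp add: eventually_sequentially_seg[of "\<lambda>n. moved X (u n) \<subseteq> _"])

text \<open>Finite intersections of an enumeration of the base at \<open>x\<close>. The enumeration
  may repeat, which also covers a finite base.\<close>

lemma first_countable_shrinking_base:
  assumes "first_countable X" "x \<in> topspace X"
  obtains B :: "nat \<Rightarrow> 'a set" where "\<And>n. openin X (B n)" "\<And>n. x \<in> B n"
    "\<And>U. openin X U \<Longrightarrow> x \<in> U \<Longrightarrow> \<forall>\<^sub>F n in sequentially. B n \<subseteq> U"
proof -
  obtain \<B> where \<B>: "countable \<B>" "\<And>V. V \<in> \<B> \<Longrightarrow> openin X V"
    "\<And>U. openin X U \<Longrightarrow> x \<in> U \<Longrightarrow> \<exists>V\<in>\<B>. x \<in> V \<and> V \<subseteq> U"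
    using assms unfolding first_countable_def by meson
  define \<C> where "\<C> = {V \<in> \<B>. x \<in> V}"
  have C: "countable \<C>" "\<C> \<noteq> {}"
    using \<B>(1) \<B>(3)[OF openin_topspace assms(2)] by (auto simp: \<C>_def)
  define B where "B n = (\<Inter>i\<le>n. from_nat_into \<C> i)" for n
  have in_C: "from_nat_into \<C> i \<in> \<C>" for i
    by (rule from_nat_into[OF C(2)])
  show thesis
  proof
    show "openin X (B n)" for n
      unfolding B_def using in_C \<B>(2) by (intro openin_INT2) (auto simp: \<C>_def)
    show "x \<in> B n" for n
      using in_C by (auto simp: B_def \<C>_def)
    fix U assume U: "openin X U" "x \<in> U"
    obtain V where V: "V \<in> \<C>" "V \<subseteq> U"
      using \<B>(3)[OF U] by (auto simp: \<C>_def)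
    obtain i where i: "from_nat_into \<C> i = V"
      using from_nat_into_surj[OF C(1) V(1)] by blast
    have "B n \<subseteq> U" if "n \<ge> i" for n
      using that i V(2) by (auto simp: B_def)
    then show "\<forall>\<^sub>F n in sequentially. B n \<subseteq> U"
      unfolding eventually_sequentially by blast
  qed
qed

section \<open>Convergent and splitting sequences of nontrivial elements\<close>

locale first_countable_moving_pair = moving_pair +
  assumes regular: "regular_space X" and first_countable: "first_countable X"
begin

definition nontrivial_seq :: "(nat \<Rightarrow> 'a \<Rightarrow> 'a) \<Rightarrow> bool" where
  "nontrivial_seq u \<longleftrightarrow> (\<forall>n. u n \<in> G \<and> u n \<noteq> \<one>\<^bsub>M\<^esub>)"

text \<open>
  The property of a dissected set, with the points of the set replaced by the supports of a sequence,
  so that it is expressed by inclusions and disjointness of supports alone.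
\<close>

definition splits :: "(nat \<Rightarrow> 'a \<Rightarrow> 'a) \<Rightarrow> bool" where
  "splits u \<longleftrightarrow>
     (\<exists>v\<in>G. v \<noteq> \<one>\<^bsub>M\<^esub> \<and>
        (\<forall>w\<in>G. w \<noteq> \<one>\<^bsub>M\<^esub> \<and> supp w \<subseteq> X closure_of supp v \<longrightarrow>
           (\<exists>g\<in>G. (\<exists>\<^sub>F n in sequentially. g ` supp (u n) \<inter> supp w \<noteq> {}) \<and>
              (\<exists>\<^sub>F n in sequentially. \<not> supp (u n) \<subseteq> X closure_of supp g))))"

lemma nontrivial_seq_moved: "nontrivial_seq u \<Longrightarrow> supp (u n) \<noteq> {}"
  by (simp add: nontrivial_seq_def moved_eq_empty)

lemma nontrivial_seq_interlace:
  "nontrivial_seq u \<Longrightarrow> nontrivial_seq v \<Longrightarrow> nontrivial_seq (interlace u v)"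
  by (simp add: nontrivial_seq_def interlace_def)

lemma tends_meets:
  assumes "nontrivial_seq u" "tends X u x" "openin X N" "x \<in> N"
  shows "\<forall>\<^sub>F n in sequentially. supp (u n) \<inter> N \<noteq> {}"
proof -
  have "\<forall>\<^sub>F n in sequentially. supp (u n) \<subseteq> N"
    using assms by (simp add: tends_def)
  then show ?thesis
    by (rule eventually_mono) (use nontrivial_seq_moved[OF assms(1)] in blast)
qed

lemma tends_in_closure:
  assumes "nontrivial_seq u" "tends X u x" "\<exists>\<^sub>F n in sequentially. supp (u n) \<subseteq> C"
  shows "x \<in> X closure_of C"
  unfolding in_closure_of
proof (intro conjI allI impI)
  show "x \<in> topspace X"
    using assms(2) by (simp add: tends_def)
  fix N assume "x \<in> N \<and> openin X N"
  then have "\<forall>\<^sub>F n in sequentially. supp (u n) \<inter> N \<noteq> {}"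
    using tends_meets[OF assms(1,2)] by blast
  then have "\<exists>\<^sub>F n in sequentially. supp (u n) \<inter> N \<noteq> {} \<and> supp (u n) \<subseteq> C"
    using assms(3) by (simp add: frequently_eventually_conj)
  then have "\<exists>n. supp (u n) \<inter> N \<noteq> {} \<and> supp (u n) \<subseteq> C"
    by (rule frequently_ex)
  then show "\<exists>y. y \<in> C \<and> y \<in> N"
    by blast
qed

lemma tends_unique:
  assumes "nontrivial_seq u" "tends X u x" "tends X u y"
  shows "x = y"
proof (rule ccontr)
  assume "x \<noteq> y"
  moreover have "x \<in> topspace X" "y \<in> topspace X"
    using assms by (auto simp: tends_def)
  ultimately obtain A B where AB: "openin X A" "openin X B" "x \<in> A" "y \<in> B" "disjnt A B"
    using Hausdorff unfolding Hausdorff_space_def by meson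
  have "\<forall>\<^sub>F n in sequentially. supp (u n) \<subseteq> A"
    using assms(2) AB by (simp add: tends_def)
  then have "y \<in> X closure_of A"
    by (intro tends_in_closure[OF assms(1,3)] eventually_frequently) auto
  then show False
    using AB unfolding in_closure_of disjnt_def by blast
qed

lemma exists_tends:
  assumes "x \<in> topspace X"
  obtains u where "nontrivial_seq u" "tends X u x"
proof -
  obtain B where B: "\<And>n. openin X (B n)" "\<And>n. x \<in> B n"
    "\<And>U. openin X U \<Longrightarrow> x \<in> U \<Longrightarrow> \<forall>\<^sub>F n in sequentially. B n \<subseteq> U"
    using first_countable_shrinking_base[OF first_countable assms] by blast
  have "\<exists>g\<in>G. g \<noteq> \<one>\<^bsub>M\<^esub> \<and> supp g \<subseteq> B n" for n
    using exists_supported[OF B(1)[of n]] B(2)[of n] by blast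
  then obtain u where u: "\<And>n. u n \<in> G \<and> u n \<noteq> \<one>\<^bsub>M\<^esub> \<and> supp (u n) \<subseteq> B n"
    by metis
  show thesis
  proof
    show "nontrivial_seq u"
      using u by (simp add: nontrivial_seq_def)
    show "tends X u x"
      unfolding tends_def
    proof (intro conjI allI impI assms)
      fix N assume "openin X N \<and> x \<in> N"
      then have "\<forall>\<^sub>F n in sequentially. B n \<subseteq> N"
        using B(3) by blast
      then show "\<forall>\<^sub>F n in sequentially. supp (u n) \<subseteq> N"
        by (rule eventually_mono) (use u in blast)
    qed
  qed
qed

text \<open>Conjugation by \<open>g\<close> replaces each support by its image under
  \<open>g\<close>, so this is continuity of \<open>g\<close> at \<open>x\<close>.\<close>

lemma tends_conj:
  assumes "g \<in> G" "\<And>n. u n \<in> G" "tends X u x"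
  shows "tends X (\<lambda>n. g \<otimes>\<^bsub>M\<^esub> u n \<otimes>\<^bsub>M\<^esub> inv\<^bsub>M\<^esub> g) (g x)"
  unfolding tends_def
proof (intro conjI allI impI)
  have x: "x \<in> topspace X"
    using assms(3) by (simp add: tends_def)
  then show "g x \<in> topspace X"
    using assms(1) by simp
  fix N assume N: "openin X N \<and> g x \<in> N"
  define N' where "N' = {y \<in> topspace X. g y \<in> N}"
  have "openin X N'" "x \<in> N'"
    using N x continuous_G[OF assms(1)] unfolding N'_def
    by (auto intro: openin_continuous_map_preimage)
  then have "\<forall>\<^sub>F n in sequentially. supp (u n) \<subseteq> N'"
    using assms(3) by (simp add: tends_def)
  then show "\<forall>\<^sub>F n in sequentially. supp (g \<otimes>\<^bsub>M\<^esub> u n \<otimes>\<^bsub>M\<^esub> inv\<^bsub>M\<^esub> g) \<subseteq> N"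
    by (rule eventually_mono) (use assms in \<open>auto simp: moved_conj N'_def\<close>)
qed

lemma nontrivial_seq_conj:
  assumes "g \<in> G" "nontrivial_seq u"
  shows "nontrivial_seq (\<lambda>n. g \<otimes>\<^bsub>M\<^esub> u n \<otimes>\<^bsub>M\<^esub> inv\<^bsub>M\<^esub> g)"
  unfolding nontrivial_seq_def
proof (intro allI conjI)
  fix n
  have u: "u n \<in> G"
    using assms(2) by (simp add: nontrivial_seq_def)
  then show "g \<otimes>\<^bsub>M\<^esub> u n \<otimes>\<^bsub>M\<^esub> inv\<^bsub>M\<^esub> g \<in> G"
    using assms(1) by simp
  then show "g \<otimes>\<^bsub>M\<^esub> u n \<otimes>\<^bsub>M\<^esub> inv\<^bsub>M\<^esub> g \<noteq> \<one>\<^bsub>M\<^esub>"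
    using moved_conj[OF u assms(1)] nontrivial_seq_moved[OF assms(2), of n] moved_eq_empty by auto
qed

text \<open>Take \<open>w\<close> inside \<open>supp v\<close> and away from \<open>x\<close>. A
  suitable \<open>g\<close> would have to fix \<open>x\<close>, as otherwise \<open>supp g\<close>
  would contain almost all supports; but then it keeps late supports near \<open>x\<close> and off
  \<open>supp w\<close>.\<close>

lemma not_splits_if_tends:
  assumes "tends X u x"
  shows "\<not> splits u"
proof
  assume "splits u"
  then obtain v where v: "v \<in> G" "v \<noteq> \<one>\<^bsub>M\<^esub>"
    and sp: "\<And>w. w \<in> G \<Longrightarrow> w \<noteq> \<one>\<^bsub>M\<^esub> \<Longrightarrow> supp w \<subseteq> X closure_of supp v \<Longrightarrow>
      \<exists>g\<in>G. (\<exists>\<^sub>F n in sequentially. g ` supp (u n) \<inter> supp w \<noteq> {}) \<and>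
        (\<exists>\<^sub>F n in sequentially. \<not> supp (u n) \<subseteq> X closure_of supp g)"
    unfolding splits_def by blast
  have x: "x \<in> topspace X"
    using assms by (simp add: tends_def)
  obtain z where z: "z \<in> supp v"
    using v moved_eq_empty by blast
  \<comment> \<open>\<open>supp v\<close> contains both \<open>z\<close> and \<open>v z\<close>,
    which are distinct, so at least one of them is not \<open>x\<close>.\<close>
  then obtain p where p: "p \<in> supp v" "p \<noteq> x"
    using moved_image[OF v(1) z] by (cases "z = x") (auto simp: moved_def)
  then have "p \<in> topspace X"
    using moved_subset by blast
  then obtain A B where AB: "openin X A" "openin X B" "p \<in> A" "x \<in> B" "disjnt A B"
    using Hausdorff x p(2) unfolding Hausdorff_space_def by meson
  obtain w where w: "w \<in> G" "w \<noteq> \<one>\<^bsub>M\<^esub>" "supp w \<subseteq> A \<inter> supp v"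
    using exists_supported[OF openin_Int[OF AB(1) openin_moved[OF v(1)]]] AB(3) p(1) by blast
  then have "supp w \<subseteq> X closure_of supp v"
    using closure_of_moved by blast
  then obtain g where g: "g \<in> G" and meet: "\<exists>\<^sub>F n in sequentially. g ` supp (u n) \<inter> supp w \<noteq> {}"
    and fix': "\<exists>\<^sub>F n in sequentially. \<not> supp (u n) \<subseteq> X closure_of supp g"
    using sp[OF w(1,2)] by blast
  have "x \<notin> supp g"
  proof
    assume "x \<in> supp g"
    then have "\<forall>\<^sub>F n in sequentially. supp (u n) \<subseteq> supp g"
      using assms openin_moved[OF g] by (simp add: tends_def)
    then have "\<forall>\<^sub>F n in sequentially. supp (u n) \<subseteq> X closure_of supp g"
      by (rule eventually_mono) (use closure_of_moved in blast)
    then show False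
      using fix' by (simp add: frequently_def)
  qed
  then have "g x = x"
    using x by (simp add: moved_def)
  then have "openin X {y \<in> topspace X. g y \<in> B}" "x \<in> {y \<in> topspace X. g y \<in> B}"
    using AB x continuous_G[OF g] by (auto intro: openin_continuous_map_preimage)
  then have "\<forall>\<^sub>F n in sequentially. supp (u n) \<subseteq> {y \<in> topspace X. g y \<in> B}"
    using assms by (simp add: tends_def)
  then have "\<forall>\<^sub>F n in sequentially. g ` supp (u n) \<inter> supp w = {}"
    by (rule eventually_mono) (use AB(5) w(3) in \<open>auto simp: disjnt_iff\<close>)
  then show False
    using meet by (simp add: frequently_def)
qed


section \<open>Extraction of refinements and criteria for splitting\<close>

lemma refines_subset:
  assumes "filterlim r sequentially sequentially" "\<And>n. supp (u n) \<subseteq> supp (v (r n))"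
  shows "refines X u v"
  unfolding refines_def using assms closure_of_moved by (meson order_trans)

lemma refines_refl: "refines X u u"
  by (rule refines_subset[where r = "\<lambda>n. n"]) (auto intro: filterlim_ident)

text \<open>Nontrivial elements are chosen inside the nonempty open sets where late supports meet
  \<open>B k\<close>. The last conclusion, an inclusion without closure, keeps the refinement inside
  any set that contains the supports of \<open>u\<close>.\<close>

lemma exists_refinement:
  assumes "\<And>n. u n \<in> G" "\<And>k. openin X (B k)"
    "\<And>k. \<exists>\<^sub>F n in sequentially. supp (u n) \<inter> B k \<noteq> {}"
  obtains u' where "nontrivial_seq u'" "refines X u' u" "\<And>k. supp (u' k) \<subseteq> B k"
    "\<And>k. \<exists>n. supp (u' k) \<subseteq> supp (u n)"
proof -
  have "\<exists>n\<ge>k. supp (u n) \<inter> B k \<noteq> {}" for k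
    using assms(3)[of k] unfolding frequently_sequentially by blast
  then obtain r where r: "\<And>k. r k \<ge> k" "\<And>k. supp (u (r k)) \<inter> B k \<noteq> {}"
    by metis
  have "\<exists>g\<in>G. g \<noteq> \<one>\<^bsub>M\<^esub> \<and> supp g \<subseteq> supp (u (r k)) \<inter> B k" for k
    using exists_supported[OF openin_Int[OF openin_moved[OF assms(1)] assms(2)] r(2)] by metis
  then obtain u' where u': "\<And>k. u' k \<in> G" "\<And>k. u' k \<noteq> \<one>\<^bsub>M\<^esub>"
    "\<And>k. supp (u' k) \<subseteq> supp (u (r k)) \<inter> B k"
    by metis
  show thesis
  proof
    show "nontrivial_seq u'"
      using u' by (simp add: nontrivial_seq_def)
    have "filterlim r sequentially sequentially"
      by (rule filterlim_at_top_mono[OF filterlim_ident]) (use r(1) in simp)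
    then show "refines X u' u"
      by (rule refines_subset) (use u'(3) in blast)
    show "supp (u' k) \<subseteq> B k" "\<exists>n. supp (u' k) \<subseteq> supp (u n)" for k
      using u'(3)[of k] by blast+
  qed
qed

lemma exists_refinement_tends:
  assumes "\<And>n. u n \<in> G" "y \<in> topspace X"
    "\<And>N. openin X N \<Longrightarrow> y \<in> N \<Longrightarrow> \<exists>\<^sub>F n in sequentially. supp (u n) \<inter> N \<noteq> {}"
  obtains u' where "nontrivial_seq u'" "refines X u' u" "tends X u' y"
proof -
  obtain B where B: "\<And>n. openin X (B n)" "\<And>n. y \<in> B n"
    "\<And>U. openin X U \<Longrightarrow> y \<in> U \<Longrightarrow> \<forall>\<^sub>F n in sequentially. B n \<subseteq> U"
    using first_countable_shrinking_base[OF first_countable assms(2)] by blast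
  obtain u' where u': "nontrivial_seq u'" "refines X u' u" "\<And>k. supp (u' k) \<subseteq> B k"
    by (rule exists_refinement[OF assms(1) B(1) assms(3)[OF B(1,2)]]) (rule that)
  have "tends X u' y"
    unfolding tends_def
  proof (intro conjI allI impI assms)
    fix N assume "openin X N \<and> y \<in> N"
    then have "\<forall>\<^sub>F n in sequentially. B n \<subseteq> N"
      using B(3) by blast
    then show "\<forall>\<^sub>F n in sequentially. supp (u' n) \<subseteq> N"
      by (rule eventually_mono) (use u'(3) in blast)
  qed
  then show thesis
    using that u' by blast
qed

text \<open>The open set \<open>supp w\<close> meets the closure of \<open>supp v\<close>, so it
  meets \<open>supp v\<close>, hence the closure of \<open>S\<close>, hence
  \<open>S\<close>.\<close>

lemma exists_in_dense_orbit:
  assumes "v \<in> G" "supp v \<subseteq> X interior_of (X closure_of S)"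
    and "w \<in> G" "w \<noteq> \<one>\<^bsub>M\<^esub>" "supp w \<subseteq> X closure_of supp v"
  shows "\<exists>s\<in>S. s \<in> supp w"
proof -
  have "supp w \<inter> X closure_of supp v \<noteq> {}"
    using assms moved_eq_empty by blast
  then have "supp w \<inter> supp v \<noteq> {}"
    using openin_Int_closure_of_eq_empty[OF openin_moved[OF assms(3)]] by blast
  then have "supp w \<inter> X closure_of S \<noteq> {}"
    using assms(2) interior_of_subset[of X "X closure_of S"] by blast
  then show ?thesis
    using openin_Int_closure_of_eq_empty[OF openin_moved[OF assms(3)], of S] by blast
qed

text \<open>\<open>DF\<close> supplies a \<open>g\<close> that takes \<open>x\<close> into
  \<open>supp w\<close> and is the identity near \<open>y\<close>: late terms of \<open>u\<close>
  are carried into \<open>supp w\<close>, and late supports of \<open>v\<close> lie where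
  \<open>g\<close> is trivial.\<close>

lemma splits_interlace_if_DF:
  assumes u: "nontrivial_seq u" "tends X u x" and v: "nontrivial_seq v" "tends X v y"
    and "DF X G x y"
  shows "splits (interlace u v)"
proof -
  let ?S = "{g x |g. g \<in> G \<and> id_near X g y}"
  have x: "x \<in> topspace X"
    using u by (simp add: tends_def)
  have "X interior_of (X closure_of ?S) \<noteq> {}"
    using assms(5) by (simp add: DF_def somewhere_dense_def)
  then obtain a where a: "a \<in> G" "a \<noteq> \<one>\<^bsub>M\<^esub>" "supp a \<subseteq> X interior_of (X closure_of ?S)"
    using exists_supported[OF openin_interior_of] by blast
  have "\<exists>g\<in>G. (\<exists>\<^sub>F n in sequentially. g ` supp (interlace u v n) \<inter> supp w \<noteq> {}) \<and>
      (\<exists>\<^sub>F n in sequentially. \<not> supp (interlace u v n) \<subseteq> X closure_of supp g)"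
    if w: "w \<in> G" "w \<noteq> \<one>\<^bsub>M\<^esub>" "supp w \<subseteq> X closure_of supp a" for w
  proof -
    obtain g where g: "g \<in> G" "id_near X g y" "g x \<in> supp w"
      using exists_in_dense_orbit[OF a(1,3) w] by blast
    then have "openin X {z \<in> topspace X. g z \<in> supp w}" "x \<in> {z \<in> topspace X. g z \<in> supp w}"
      using x openin_moved[OF w(1)] continuous_G[OF g(1)]
      by (auto intro: openin_continuous_map_preimage)
    then have "\<forall>\<^sub>F n in sequentially. supp (u n) \<subseteq> {z \<in> topspace X. g z \<in> supp w}"
      using u(2) by (simp add: tends_def)
    then have "\<forall>\<^sub>F n in sequentially. g ` supp (u n) \<inter> supp w \<noteq> {}"
      by (rule eventually_mono) (use nontrivial_seq_moved[OF u(1)] in blast)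
    then have "\<exists>\<^sub>F n in sequentially. g ` supp (u n) \<inter> supp w \<noteq> {}"
      by (rule eventually_frequently[OF sequentially_bot])
    then have 1: "\<exists>\<^sub>F n in sequentially. g ` supp (interlace u v n) \<inter> supp w \<noteq> {}"
      using frequently_interlace[where P = "\<lambda>f. g ` supp f \<inter> supp w \<noteq> {}"] by blast
    obtain S where S: "openin X S" "y \<in> S" "\<forall>z\<in>S. g z = z"
      using g(2) unfolding id_near_def by blast
    then have "S \<inter> supp g = {}"
      by (auto simp: moved_def)
    then have "S \<inter> X closure_of supp g = {}"
      using openin_Int_closure_of_eq_empty[OF S(1)] by blast
    moreover have "\<forall>\<^sub>F n in sequentially. supp (v n) \<subseteq> S"
      using v(2) S by (simp add: tends_def)
    ultimately have "\<forall>\<^sub>F n in sequentially. \<not> supp (v n) \<subseteq> X closure_of supp g"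
      by (elim eventually_mono) (use nontrivial_seq_moved[OF v(1)] in blast)
    then have "\<exists>\<^sub>F n in sequentially. \<not> supp (v n) \<subseteq> X closure_of supp g"
      by (rule eventually_frequently[OF sequentially_bot])
    then have "\<exists>\<^sub>F n in sequentially. \<not> supp (interlace u v n) \<subseteq> X closure_of supp g"
      using frequently_interlace[where P = "\<lambda>f. \<not> supp f \<subseteq> X closure_of supp g"] by blast
    then show ?thesis
      using 1 g(1) by blast
  qed
  then show ?thesis
    using a(1,2) unfolding splits_def by blast
qed

text \<open>One point of the dense set \<open>D\<close> is picked from each support. Without
  accumulation of the supports these points form an infinite discrete set, and an element dissecting
  it also acts as required on the supports around the points.\<close>

lemma splits_if_no_accumulation:
  assumes v: "nontrivial_seq v" "\<And>n. supp (v n) \<subseteq> F" and F: "flexible X G F"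
    and no_acc: "\<And>y. y \<in> topspace X \<Longrightarrow>
      \<exists>N. openin X N \<and> y \<in> N \<and> (\<forall>\<^sub>F n in sequentially. supp (v n) \<inter> N = {})"
  shows "splits v"
proof -
  obtain D where D: "D \<subseteq> F" "F \<subseteq> X closure_of D"
    and diss: "\<And>A. A \<subseteq> D \<Longrightarrow> infinite A \<Longrightarrow> discrete_in X A \<Longrightarrow> dissectable X G A"
    using F unfolding flexible_def by blast
  have vG: "v n \<in> G" for n
    using v(1) by (simp add: nontrivial_seq_def)
  have "supp (v n) \<inter> D \<noteq> {}" for n
  proof -
    have "supp (v n) \<inter> X closure_of D \<noteq> {}"
      using nontrivial_seq_moved[OF v(1), of n] v(2)[of n] D(2) by blast
    then show ?thesis
      using openin_Int_closure_of_eq_empty[OF openin_moved[OF vG]] by blast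
  qed
  then have "\<exists>p. p \<in> supp (v n) \<inter> D" for n
    by blast
  then obtain a where a: "\<And>n. a n \<in> supp (v n)" "\<And>n. a n \<in> D"
    by (metis IntD1 IntD2)
  have aX: "a n \<in> topspace X" for n
    using a(1) moved_subset by blast
  have locally_finite: "\<exists>N. openin X N \<and> y \<in> N \<and> finite {n. a n \<in> N}" if y: "y \<in> topspace X" for y
  proof -
    obtain N where N: "openin X N" "y \<in> N" "\<forall>\<^sub>F n in sequentially. supp (v n) \<inter> N = {}"
      using no_acc[OF y] by blast
    then have "\<forall>\<^sub>F n in sequentially. a n \<notin> N"
      using a(1) by (elim eventually_mono) blast
    then have "finite {n. a n \<in> N}"
      by (simp add: cofinite_eq_sequentially[symmetric] eventually_cofinite)
    then show ?thesis
      using N by blast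
  qed
  \<comment> \<open>The choice \<open>a\<close> may repeat values, but each only finitely often, so
    its range is infinite.\<close>
  have fin: "finite {n. a n = p}" for p
  proof (cases "p \<in> topspace X")
    case True
    then obtain N where "p \<in> N" "finite {n. a n \<in> N}"
      using locally_finite by blast
    then show ?thesis
      by (elim rev_finite_subset) blast
  next
    case False
    then have "{n. a n = p} = {}"
      using aX by blast
    then show ?thesis
      by simp
  qed
  let ?A = "range a"
  have "infinite ?A"
  proof
    assume "finite ?A"
    then have "finite (\<Union>p\<in>?A. {n. a n = p})"
      using fin by blast
    moreover have "(\<Union>p\<in>?A. {n. a n = p}) = UNIV"
      by blast
    ultimately show False
      by simp
  qed
  moreover have "discrete_in X ?A"
    unfolding discrete_in_def
  proof (intro conjI)
    show "?A \<subseteq> topspace X"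
      using aX by blast
    have "y \<notin> X derived_set_of ?A" for y
    proof
      assume y: "y \<in> X derived_set_of ?A"
      then have yX: "y \<in> topspace X"
        by (simp add: in_derived_set_of)
      then obtain N where N: "openin X N" "y \<in> N" "finite {n. a n \<in> N}"
        using locally_finite by blast
      \<comment> \<open>Only finitely many points of the range other than \<open>y\<close> lie in
        \<open>N\<close>; finite sets are closed, so removing them leaves a neighborhood of
        \<open>y\<close>.\<close>
      let ?B = "a ` {n. a n \<in> N} - {y}"
      have "closedin X ?B"
        using Hausdorff N(3) aX by (intro closedin_Hausdorff_finite) auto
      then have "openin X (N - ?B)" "y \<in> N - ?B"
        using N by (auto intro: openin_diff)
      then have "\<exists>z. z \<noteq> y \<and> z \<in> ?A \<and> z \<in> N - ?B"
        using y unfolding in_derived_set_of by meson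
      then show False
        by blast
    qed
    then show "X derived_set_of ?A = {}"
      by blast
  qed
  ultimately have "dissectable X G ?A"
    using diss[of ?A] a(2) by blast
  then obtain V where "dissects X G V ?A"
    unfolding dissectable_def by blast
  then have V: "openin X V" "V \<noteq> {}"
    and dis: "\<forall>W. openin X W \<and> W \<noteq> {} \<and> W \<subseteq> V \<longrightarrow>
      (\<exists>g\<in>G. infinite {p \<in> ?A. g p \<in> W} \<and> infinite {p \<in> ?A. id_near X g p})"
    unfolding dissects_def by simp_all
  \<comment> \<open>Dissection counts points while \<open>splits\<close> counts indices; infinitely
    many points need infinitely many indices.\<close>
  have freq: "\<exists>\<^sub>F n in sequentially. P (a n)" if "infinite {p \<in> ?A. P p}" for P
  proof -
    have "{p \<in> ?A. P p} \<subseteq> a ` {n. P (a n)}"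
      by blast
    then have "infinite {n. P (a n)}"
      using that by (meson finite_imageI finite_subset)
    then show ?thesis
      by (simp add: cofinite_eq_sequentially[symmetric] frequently_cofinite)
  qed
  obtain b where b: "b \<in> G" "b \<noteq> \<one>\<^bsub>M\<^esub>" "supp b \<subseteq> V"
    using exists_supported[OF V] by blast
  have "\<exists>g\<in>G. (\<exists>\<^sub>F n in sequentially. g ` supp (v n) \<inter> supp w \<noteq> {}) \<and>
      (\<exists>\<^sub>F n in sequentially. \<not> supp (v n) \<subseteq> X closure_of supp g)"
    if w: "w \<in> G" "w \<noteq> \<one>\<^bsub>M\<^esub>" "supp w \<subseteq> X closure_of supp b" for w
  proof -
    have "supp w \<inter> X closure_of supp b \<noteq> {}"
      using w moved_eq_empty by blast
    then have "supp w \<inter> supp b \<noteq> {}"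
      using openin_Int_closure_of_eq_empty[OF openin_moved[OF w(1)]] by blast
    then have "supp w \<inter> V \<noteq> {}"
      using b(3) by blast
    then obtain g where g: "g \<in> G" "infinite {p \<in> ?A. g p \<in> supp w \<inter> V}"
      "infinite {p \<in> ?A. id_near X g p}"
      using dis[rule_format, of "supp w \<inter> V"] openin_Int[OF openin_moved[OF w(1)] V(1)] by auto
    have "\<exists>\<^sub>F n in sequentially. g ` supp (v n) \<inter> supp w \<noteq> {}"
      using freq[OF g(2)] by (rule frequently_elim1) (use a(1) in blast)
    moreover have "\<exists>\<^sub>F n in sequentially. \<not> supp (v n) \<subseteq> X closure_of supp g"
      using freq[OF g(3)]
    proof (rule frequently_elim1)
      fix n assume "id_near X g (a n)"
      then obtain S where S: "openin X S" "a n \<in> S" "\<forall>z\<in>S. g z = z"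
        unfolding id_near_def by blast
      then have "S \<inter> supp g = {}"
        by (auto simp: moved_def)
      then have "S \<inter> X closure_of supp g = {}"
        using openin_Int_closure_of_eq_empty[OF S(1)] by blast
      then show "\<not> supp (v n) \<subseteq> X closure_of supp g"
        using S(2) a(1) by blast
    qed
    ultimately show ?thesis
      using g(1) by blast
  qed
  then show ?thesis
    using b(1,2) unfolding splits_def by blast
qed

end

section \<open>Flexible pairs, the setting common to both classes\<close>

locale flexible_pair = first_countable_moving_pair +
  assumes flexible_cover: "\<Union> {U. flexible X G U} = topspace X"
    and DF: "\<And>x y. x \<in> Dset X G \<Longrightarrow> y \<in> Dset X G \<Longrightarrow> x \<noteq> y \<Longrightarrow> DF X G x y \<or> DF X G y x"
begin

text \<open>Some refinement tends to a point \<open>y\<close>. If \<open>u\<close> itself did not,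
  another refinement would stay away from \<open>y\<close> and tend to some \<open>z\<close>
  distinct from \<open>y\<close>; interlacing the two gives a refinement of \<open>u\<close> that
  splits by \<open>DF\<close>. The hypothesis \<open>lim\<close> places both limits in
  \<open>Dset X G\<close>, where \<open>DF\<close> applies.\<close>

lemma tends_if_not_splits:
  assumes u: "nontrivial_seq u" "\<And>n. supp (u n) \<subseteq> F" and F: "flexible X G F"
    and unsplit: "\<And>u'. nontrivial_seq u' \<Longrightarrow> refines X u' u \<Longrightarrow> \<not> splits u'"
    and lim: "\<And>u' y. nontrivial_seq u' \<Longrightarrow> refines X u' u \<Longrightarrow> tends X u' y \<Longrightarrow> y \<in> Dset X G"
  shows "\<exists>y\<in>Dset X G. tends X u y"
proof -
  have uG: "u n \<in> G" for n
    using u(1) by (simp add: nontrivial_seq_def)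
  have acc: "\<exists>u2 y. nontrivial_seq u2 \<and> refines X u2 u1 \<and> tends X u2 y"
    if u1: "nontrivial_seq u1" "refines X u1 u" "\<And>n. supp (u1 n) \<subseteq> F" for u1
  proof -
    have "\<not> splits u1"
      using unsplit u1 by blast
    then obtain y where y: "y \<in> topspace X"
      "\<And>N. openin X N \<Longrightarrow> y \<in> N \<Longrightarrow> \<not> (\<forall>\<^sub>F n in sequentially. supp (u1 n) \<inter> N = {})"
      using splits_if_no_accumulation[OF u1(1,3) F] by blast
    have freq: "\<exists>\<^sub>F n in sequentially. supp (u1 n) \<inter> N \<noteq> {}" if "openin X N" "y \<in> N" for N
      using y(2)[OF that] by (simp add: frequently_def)
    have u1G: "u1 n \<in> G" for n
      using u1(1) by (simp add: nontrivial_seq_def)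
    show ?thesis
      by (rule exists_refinement_tends[OF u1G y(1) freq]) blast+
  qed
  obtain u1 y where u1: "nontrivial_seq u1" "refines X u1 u" "tends X u1 y"
    using acc[OF u(1) refines_refl u(2)] by blast
  have yD: "y \<in> Dset X G"
    using lim[OF u1] .
  have "tends X u y"
  proof (rule ccontr)
    assume "\<not> tends X u y"
    then obtain N where N: "openin X N" "y \<in> N" "\<not> (\<forall>\<^sub>F n in sequentially. supp (u n) \<subseteq> N)"
      using u1(3) unfolding tends_def by blast
    obtain V where V: "openin X V" "y \<in> V" "X closure_of V \<subseteq> N"
      using regular_space_closure_nbhd[OF regular N(1,2)] by blast
    have "\<exists>\<^sub>F n in sequentially. \<not> supp (u n) \<subseteq> N"
      using N(3) by (simp add: frequently_def)
    \<comment> \<open>A support not inside \<open>N\<close> meets the complement of the closure of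
      \<open>V\<close>, an open set in which a refinement can be chosen.\<close>
    then have freq: "\<exists>\<^sub>F n in sequentially. supp (u n) \<inter> (topspace X - X closure_of V) \<noteq> {}"
      by (rule frequently_elim1) (use V(3) moved_subset in blast)
    have "openin X (topspace X - X closure_of V)"
      by (intro openin_diff) auto
    then obtain u2 where u2: "nontrivial_seq u2" "refines X u2 u"
      "\<And>k. supp (u2 k) \<subseteq> topspace X - X closure_of V" "\<And>k. \<exists>n. supp (u2 k) \<subseteq> supp (u n)"
      by (rule exists_refinement[OF uG _ freq]) (rule that)
    have "supp (u2 k) \<subseteq> F" for k
      using u2(4)[of k] u(2) by blast
    then obtain u3 z where u3: "nontrivial_seq u3" "refines X u3 u2" "tends X u3 z"
      using acc[OF u2(1,2)] by blast
    have u3u: "refines X u3 u"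
      by (rule refines_trans[OF u3(2) u2(2)])
    \<comment> \<open>The supports of \<open>u2\<close> miss the open set \<open>V\<close>, so their
      closures miss it too; a refinement of \<open>u2\<close> cannot have supports inside
      \<open>V\<close>.\<close>
    have "y \<noteq> z"
    proof
      assume "y = z"
      then have "\<forall>\<^sub>F n in sequentially. supp (u3 n) \<subseteq> V"
        using u3(3) V by (simp add: tends_def)
      then obtain n where n: "supp (u3 n) \<subseteq> V"
        unfolding eventually_sequentially by blast
      obtain m where m: "supp (u3 n) \<subseteq> X closure_of supp (u2 m)"
        using u3(2) unfolding refines_def by blast
      have "V \<inter> supp (u2 m) = {}"
        using u2(3)[of m] closure_of_subset[OF openin_subset[OF V(1)]] by blast
      then have "V \<inter> X closure_of supp (u2 m) = {}"
        using openin_Int_closure_of_eq_empty[OF V(1)] by blast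
      then show False
        using n m nontrivial_seq_moved[OF u3(1), of n] by blast
    qed
    then have "splits (interlace u1 u3) \<or> splits (interlace u3 u1)"
      using DF[OF yD lim[OF u3(1) u3u u3(3)]] splits_interlace_if_DF u1 u3 by blast
    then show False
      using unsplit nontrivial_seq_interlace refines_interlace u1 u3 u3u by blast
  qed
  then show ?thesis
    using yD by blast
qed

lemma Dset_closed: "g \<in> G \<Longrightarrow> x \<in> Dset X G \<Longrightarrow> g x \<in> Dset X G"
proof -
  assume g: "g \<in> G" and x: "x \<in> Dset X G"
  then have xX: "x \<in> topspace X"
    by (simp add: Dset_def)
  have "{h (g x) |h. h \<in> G} = {h x |h. h \<in> G}"
  proof (intro equalityI subsetI)
    fix z assume "z \<in> {h (g x) |h. h \<in> G}"
    then obtain h where "h \<in> G" "z = (h \<otimes>\<^bsub>M\<^esub> g) x"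
      using g xX by auto
    then show "z \<in> {h x |h. h \<in> G}"
      using g mult_closed' by blast
  next
    fix z assume "z \<in> {h x |h. h \<in> G}"
    then obtain h where h: "h \<in> G" "z = h x"
      by blast
    then have "z = (h \<otimes>\<^bsub>M\<^esub> inv\<^bsub>M\<^esub> g) (g x)"
      using g xX by simp
    then show "z \<in> {h (g x) |h. h \<in> G}"
      using g h mult_closed' inv_closed' by blast
  qed
  then show ?thesis
    using x g by (simp add: Dset_def)
qed

end
section \<open>Transporting limits along an isomorphism\<close>

locale isomorphic_pairs = A: flexible_pair X G + B: flexible_pair Y H
  for X :: "'a topology" and G and Y :: "'b topology" and H +
  fixes \<phi>
  assumes iso: "\<phi> \<in> iso (group_of X G) (group_of Y H)"
begin

interpretation hom: group_hom "group_of X G" "group_of Y H" \<phi>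
  using A.M.is_group B.M.is_group iso by (simp add: group_hom_def group_hom_axioms_def iso_def)

lemma im: "\<phi> ` G = H" and inj: "inj_on \<phi> G"
  using iso by (simp_all add: Group.iso_iff)

lemma ball_H: "(\<forall>h\<in>H. P h) \<longleftrightarrow> (\<forall>g\<in>G. P (\<phi> g))"
  and bex_H: "(\<exists>h\<in>H. P h) \<longleftrightarrow> (\<exists>g\<in>G. P (\<phi> g))"
  using im by blast+

lemma \<phi>_closed [simp]: "g \<in> G \<Longrightarrow> \<phi> g \<in> H"
  using im by blast

lemma \<phi>_eq_one: "g \<in> G \<Longrightarrow> \<phi> g = \<one>\<^bsub>B.M\<^esub> \<longleftrightarrow> g = \<one>\<^bsub>A.M\<^esub>"
  using iso_eq_one[OF A.M.is_group B.M.is_group iso] by simp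

lemma \<phi>_conj:
  "g \<in> G \<Longrightarrow> f \<in> G \<Longrightarrow>
    \<phi> (g \<otimes>\<^bsub>A.M\<^esub> f \<otimes>\<^bsub>A.M\<^esub> inv\<^bsub>A.M\<^esub> g) = \<phi> g \<otimes>\<^bsub>B.M\<^esub> \<phi> f \<otimes>\<^bsub>B.M\<^esub> inv\<^bsub>B.M\<^esub> \<phi> g"
  by simp

lemma obtain_preimage:
  assumes "h \<in> H"
  obtains g where "g \<in> G" "h = \<phi> g"
  using assms im by blast

lemma le_iff:
  assumes "f \<in> G" "g \<in> G"
  shows "B.supp (\<phi> f) \<subseteq> Y closure_of B.supp (\<phi> g) \<longleftrightarrow> A.supp f \<subseteq> X closure_of A.supp g"
  using assms iso_alg_le[OF A.M.is_group B.M.is_group iso, of f g]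
  by (simp add: A.alg_le_iff B.alg_le_iff)

lemma disjoint_iff:
  assumes "f \<in> G" "g \<in> G"
  shows "B.supp (\<phi> f) \<inter> B.supp (\<phi> g) = {} \<longleftrightarrow> A.supp f \<inter> A.supp g = {}"
proof -
  have "alg_le B.M (\<phi> m) (\<phi> f) = alg_le A.M m f" "alg_le B.M (\<phi> m) (\<phi> g) = alg_le A.M m g"
    if "m \<in> G" for m
    using assms that iso_alg_le[OF A.M.is_group B.M.is_group iso] by simp_all
  then have "(\<forall>m\<in>H. alg_le B.M m (\<phi> f) \<and> alg_le B.M m (\<phi> g) \<longrightarrow> m = \<one>\<^bsub>B.M\<^esub>) \<longleftrightarrow>
      (\<forall>m\<in>G. alg_le A.M m f \<and> alg_le A.M m g \<longrightarrow> m = \<one>\<^bsub>A.M\<^esub>)"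
    by (simp add: \<phi>_eq_one ball_H)
  then show ?thesis
    using assms by (simp add: A.disjoint_iff_alg_le B.disjoint_iff_alg_le)
qed

lemma image_disjoint_iff:
  assumes "f \<in> G" "g \<in> G" "h \<in> G"
  shows "\<phi> h ` B.supp (\<phi> f) \<inter> B.supp (\<phi> g) = {} \<longleftrightarrow> h ` A.supp f \<inter> A.supp g = {}"
  using disjoint_iff[of "h \<otimes>\<^bsub>A.M\<^esub> f \<otimes>\<^bsub>A.M\<^esub> inv\<^bsub>A.M\<^esub> h" g] assms
  by (simp add: A.moved_conj B.moved_conj)

text \<open>\<open>splits\<close> is built from inclusion in closed supports and disjointness of
  translated supports, both transported by \<open>\<phi>\<close>.\<close>

lemma splits_iff:
  assumes u: "\<And>n. u n \<in> G"
  shows "B.splits (\<phi> \<circ> u) \<longleftrightarrow> A.splits u"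
  unfolding A.splits_def B.splits_def ball_H bex_H
  by (intro bex_cong ball_cong refl conj_cong imp_cong)
    (simp_all add: u \<phi>_eq_one le_iff image_disjoint_iff)

lemma nontrivial_seq_iff:
  "(\<And>n. u n \<in> G) \<Longrightarrow> B.nontrivial_seq (\<phi> \<circ> u) \<longleftrightarrow> A.nontrivial_seq u"
  by (simp add: A.nontrivial_seq_def B.nontrivial_seq_def \<phi>_eq_one)

lemma refines_iff:
  "(\<And>n. u n \<in> G) \<Longrightarrow> (\<And>n. v n \<in> G) \<Longrightarrow> refines Y (\<phi> \<circ> u) (\<phi> \<circ> v) \<longleftrightarrow> refines X u v"
  by (simp add: refines_def le_iff)

lemma seq_preimage:
  assumes "B.nontrivial_seq u"
  obtains v where "A.nontrivial_seq v" "u = \<phi> \<circ> v"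
proof -
  have "\<forall>n. \<exists>g\<in>G. u n = \<phi> g"
    using assms im unfolding B.nontrivial_seq_def by blast
  then obtain v where v: "\<And>n. v n \<in> G" "\<And>n. u n = \<phi> (v n)"
    by metis
  then have "u = \<phi> \<circ> v"
    by auto
  then show thesis
    using that[of v] assms nontrivial_seq_iff[of v] v(1) by simp
qed

lemma swap: "isomorphic_pairs Y H X G (inv_into G \<phi>)"
proof -
  have "inv_into (carrier A.M) \<phi> \<in> iso B.M A.M"
    by (rule A.M.iso_set_sym[OF iso])
  then show ?thesis
    using A.flexible_pair_axioms B.flexible_pair_axioms
    by (simp add: isomorphic_pairs_def isomorphic_pairs_axioms_def)
qed

text \<open>
  The orbit of \<open>x\<close> is dense in some open set, and translates of the sequence follow \<open>x\<close> along its orbit.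
  This is seen on the other side too, where it brings translates of the sequence into prescribed
  open sets.
\<close>

lemma exists_translate_inside:
  assumes u: "A.nontrivial_seq u" "tends X u x" and x: "x \<in> Dset X G"
  shows "\<exists>v\<in>H. v \<noteq> \<one>\<^bsub>B.M\<^esub> \<and> (\<forall>N. openin Y N \<and> N \<inter> B.supp v \<noteq> {} \<longrightarrow>
      (\<exists>h\<in>G. \<forall>\<^sub>F n in sequentially. \<phi> h ` B.supp (\<phi> (u n)) \<subseteq> N))"
proof -
  let ?S = "{g x |g. g \<in> G}"
  have uG: "u n \<in> G" for n
    using u(1) by (simp add: A.nontrivial_seq_def)
  have xX: "x \<in> topspace X"
    using x by (simp add: Dset_def)
  have "X interior_of (X closure_of ?S) \<noteq> {}"
    using x by (simp add: Dset_def somewhere_dense_def)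
  then obtain a where a: "a \<in> G" "a \<noteq> \<one>\<^bsub>A.M\<^esub>" "A.supp a \<subseteq> X interior_of (X closure_of ?S)"
    using A.exists_supported[OF openin_interior_of] by blast
  have "\<exists>h\<in>G. \<forall>\<^sub>F n in sequentially. \<phi> h ` B.supp (\<phi> (u n)) \<subseteq> N"
    if N: "openin Y N" "N \<inter> B.supp (\<phi> a) \<noteq> {}" for N
  proof -
    have op: "openin Y (N \<inter> B.supp (\<phi> a))"
      using N(1) B.openin_moved[OF \<phi>_closed[OF a(1)]] by blast
    obtain y where y: "y \<in> N \<inter> B.supp (\<phi> a)"
      using N(2) by blast
    obtain V where V: "openin Y V" "y \<in> V" "Y closure_of V \<subseteq> N \<inter> B.supp (\<phi> a)"
      using regular_space_closure_nbhd[OF B.regular op y] by blast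
    obtain w' where w': "w' \<in> H" "w' \<noteq> \<one>\<^bsub>B.M\<^esub>" "B.supp w' \<subseteq> V"
      using B.exists_supported[OF V(1)] V(2) by blast
    obtain w where w: "w \<in> G" "w' = \<phi> w"
      using obtain_preimage[OF w'(1)] by blast
    have V_sub: "V \<subseteq> Y closure_of V"
      by (rule closure_of_subset[OF openin_subset[OF V(1)]])
    have "B.supp (\<phi> w) \<subseteq> Y closure_of B.supp (\<phi> a)"
      using w'(3) w(2) V(3) V_sub B.closure_of_moved[of "\<phi> a"] by blast
    then have "A.supp w \<subseteq> X closure_of A.supp a"
      using le_iff[OF w(1) a(1)] by blast
    moreover have "w \<noteq> \<one>\<^bsub>A.M\<^esub>"
      using w w'(2) \<phi>_eq_one by blast
    ultimately obtain h where h: "h \<in> G" "h x \<in> A.supp w"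
      using A.exists_in_dense_orbit[OF a(1,3) w(1)] by blast
    have "\<forall>\<^sub>F n in sequentially. A.supp (h \<otimes>\<^bsub>A.M\<^esub> u n \<otimes>\<^bsub>A.M\<^esub> inv\<^bsub>A.M\<^esub> h) \<subseteq> A.supp w"
      using A.tends_conj[OF h(1) uG u(2)] h(2) A.openin_moved[OF w(1)] by (simp add: tends_def)
    then have "\<forall>\<^sub>F n in sequentially. \<phi> h ` B.supp (\<phi> (u n)) \<subseteq> N"
    proof (rule eventually_mono)
      fix n
      let ?c = "h \<otimes>\<^bsub>A.M\<^esub> u n \<otimes>\<^bsub>A.M\<^esub> inv\<^bsub>A.M\<^esub> h"
      assume "A.supp ?c \<subseteq> A.supp w"
      then have "A.supp ?c \<subseteq> X closure_of A.supp w"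
        using A.closure_of_moved[of w] by blast
      then have "B.supp (\<phi> ?c) \<subseteq> Y closure_of B.supp (\<phi> w)"
        using le_iff[of ?c w] uG h(1) w(1) by simp
      moreover have "B.supp (\<phi> ?c) = \<phi> h ` B.supp (\<phi> (u n))"
        using \<phi>_conj[OF h(1) uG] B.moved_conj[OF \<phi>_closed[OF uG] \<phi>_closed[OF h(1)]] by simp
      moreover have "Y closure_of B.supp (\<phi> w) \<subseteq> Y closure_of V"
        using w'(3) w(2) by (intro closure_of_mono) simp
      ultimately show "\<phi> h ` B.supp (\<phi> (u n)) \<subseteq> N"
        using V(3) by blast
    qed
    then show ?thesis
      using h(1) by blast
  qed
  then show ?thesis
    using a \<phi>_eq_one by (intro bexI[of _ "\<phi> a"]) auto
qed

text \<open>Translates of \<open>\<phi> \<circ> u\<close> tend to points of the orbit of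
  \<open>y\<close>, and some of them enter any open set that meets \<open>supp v\<close>. Hence the
  orbit of \<open>y\<close> is dense in \<open>supp v\<close>.\<close>

lemma limit_in_Dset:
  assumes u: "A.nontrivial_seq u" "tends X u x" and x: "x \<in> Dset X G"
    and y: "tends Y (\<phi> \<circ> u) y"
  shows "y \<in> Dset Y H"
proof -
  have uG: "u n \<in> G" for n
    using u(1) by (simp add: A.nontrivial_seq_def)
  have u': "B.nontrivial_seq (\<phi> \<circ> u)"
    using u(1) nontrivial_seq_iff[OF uG] by simp
  have yY: "y \<in> topspace Y"
    using y by (simp add: tends_def)
  obtain v where v: "v \<in> H" "v \<noteq> \<one>\<^bsub>B.M\<^esub>"
    and inside: "\<And>N. openin Y N \<Longrightarrow> N \<inter> B.supp v \<noteq> {} \<Longrightarrow>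
      \<exists>h\<in>G. \<forall>\<^sub>F n in sequentially. \<phi> h ` B.supp (\<phi> (u n)) \<subseteq> N"
    using exists_translate_inside[OF u x] by blast
  let ?S = "{g y |g. g \<in> H}"
  have "B.supp v \<subseteq> Y closure_of ?S"
  proof
    fix z assume z: "z \<in> B.supp v"
    show "z \<in> Y closure_of ?S"
      unfolding in_closure_of
    proof (intro conjI allI impI)
      show "z \<in> topspace Y"
        using z B.moved_subset by blast
      fix N assume "z \<in> N \<and> openin Y N"
      \<comment> \<open>Supports inside \<open>V\<close> only place the limit in the closure of
        \<open>V\<close>, so that closure has to fit into \<open>N\<close>.\<close>
      then obtain V where V: "openin Y V" "z \<in> V" "Y closure_of V \<subseteq> N"
        using regular_space_closure_nbhd[OF B.regular] by metis
      then obtain h where h: "h \<in> G" "\<forall>\<^sub>F n in sequentially. \<phi> h ` B.supp (\<phi> (u n)) \<subseteq> V"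
        using inside[of V] z by blast
      let ?c = "\<lambda>n. \<phi> h \<otimes>\<^bsub>B.M\<^esub> (\<phi> \<circ> u) n \<otimes>\<^bsub>B.M\<^esub> inv\<^bsub>B.M\<^esub> \<phi> h"
      have "\<forall>\<^sub>F n in sequentially. B.supp (?c n) \<subseteq> V"
        using h(2) by (rule eventually_mono) (use uG h(1) in \<open>simp add: B.moved_conj\<close>)
      then have "\<exists>\<^sub>F n in sequentially. B.supp (?c n) \<subseteq> V"
        by (rule eventually_frequently[OF sequentially_bot])
      moreover have "tends Y ?c (\<phi> h y)"
        using B.tends_conj[of "\<phi> h" "\<phi> \<circ> u" y] h(1) uG y by simp
      moreover have "B.nontrivial_seq ?c"
        using B.nontrivial_seq_conj[OF \<phi>_closed[OF h(1)] u'] .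
      ultimately have "\<phi> h y \<in> Y closure_of V"
        by (intro B.tends_in_closure)
      then show "\<exists>q. q \<in> ?S \<and> q \<in> N"
        using V(3) \<phi>_closed[OF h(1)] by blast
    qed
  qed
  then have "B.supp v \<subseteq> Y interior_of (Y closure_of ?S)"
    using interior_of_maximal B.openin_moved[OF v(1)] by blast
  then have "somewhere_dense Y ?S"
    using v B.moved_eq_empty unfolding somewhere_dense_def by blast
  then show ?thesis
    using yY by (simp add: Dset_def)
qed

text \<open>A translate of the tail is brought into a flexible set, where
  \<open>tends_if_not_splits\<close> yields a limit; translating back gives the limit of the
  original sequence.\<close>

lemma exists_limit:
  assumes u: "A.nontrivial_seq u" "tends X u x" and x: "x \<in> Dset X G"
  shows "\<exists>y\<in>Dset Y H. tends Y (\<phi> \<circ> u) y"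
proof -
  have uG: "u n \<in> G" for n
    using u(1) by (simp add: A.nontrivial_seq_def)
  obtain v where v: "v \<in> H" "v \<noteq> \<one>\<^bsub>B.M\<^esub>"
    and inside: "\<And>N. openin Y N \<Longrightarrow> N \<inter> B.supp v \<noteq> {} \<Longrightarrow>
      \<exists>h\<in>G. \<forall>\<^sub>F n in sequentially. \<phi> h ` B.supp (\<phi> (u n)) \<subseteq> N"
    using exists_translate_inside[OF u x] by blast
  obtain q where q: "q \<in> B.supp v"
    using v B.moved_eq_empty by blast
  then obtain F where F: "flexible Y H F" "q \<in> F"
    using B.flexible_cover B.moved_subset by blast
  then have "openin Y F"
    by (simp add: flexible_def)
  then obtain h where h: "h \<in> G" "\<forall>\<^sub>F n in sequentially. \<phi> h ` B.supp (\<phi> (u n)) \<subseteq> F"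
    using inside[of F] q F(2) by blast
  then obtain k where k: "\<And>n. n \<ge> k \<Longrightarrow> \<phi> h ` B.supp (\<phi> (u n)) \<subseteq> F"
    unfolding eventually_sequentially by blast
  \<comment> \<open>The shift by \<open>k\<close> discards the terms whose translated images are not
    yet known to lie in \<open>F\<close>.\<close>
  define c where "c n = h \<otimes>\<^bsub>A.M\<^esub> u (n + k) \<otimes>\<^bsub>A.M\<^esub> inv\<^bsub>A.M\<^esub> h" for n
  have cG: "c n \<in> G" for n
    using h(1) uG by (simp add: c_def)
  have c: "A.nontrivial_seq c" "tends X c (h x)"
    using A.nontrivial_seq_conj[OF h(1), of "\<lambda>n. u (n + k)"]
      A.tends_conj[OF h(1), of "\<lambda>n. u (n + k)" x] u uG
    by (simp_all add: c_def[abs_def] tends_shift A.nontrivial_seq_def)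
  have hx: "h x \<in> Dset X G"
    by (rule A.Dset_closed[OF h(1) x])
  have \<phi>c: "(\<phi> \<circ> c) n = \<phi> h \<otimes>\<^bsub>B.M\<^esub> \<phi> (u (n + k)) \<otimes>\<^bsub>B.M\<^esub> inv\<^bsub>B.M\<^esub> \<phi> h" for n
    using \<phi>_conj[OF h(1) uG] by (simp add: c_def)
  have "\<exists>y\<in>Dset Y H. tends Y (\<phi> \<circ> c) y"
  proof (rule B.tends_if_not_splits[OF _ _ F(1)])
    show "B.nontrivial_seq (\<phi> \<circ> c)"
      using c(1) nontrivial_seq_iff[OF cG] by simp
    show "B.supp ((\<phi> \<circ> c) n) \<subseteq> F" for n
      unfolding \<phi>c using k[of "n + k"] B.moved_conj[OF \<phi>_closed[OF uG] \<phi>_closed[OF h(1)]] by simp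
  next
    \<comment> \<open>A refinement on this side pulls back to a refinement of \<open>c\<close>,
      which still tends to \<open>h x\<close> and therefore does not split.\<close>
    fix u' assume u': "B.nontrivial_seq u'" "refines Y u' (\<phi> \<circ> c)"
    obtain w where w: "A.nontrivial_seq w" "u' = \<phi> \<circ> w"
      using seq_preimage[OF u'(1)] by blast
    then have wG: "w n \<in> G" for n
      by (simp add: A.nontrivial_seq_def)
    have "refines X w c"
      using u'(2) w(2) refines_iff[OF wG cG] by simp
    then have wt: "tends X w (h x)"
      by (rule tends_refines[OF A.regular c(2)])
    then show "\<not> B.splits u'"
      using A.not_splits_if_tends splits_iff[OF wG] w(2) by simp
    show "y \<in> Dset Y H" if "tends Y u' y" for y
      using limit_in_Dset[OF w(1) wt hx] that w(2) by simp
  qed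
  then obtain y where y: "y \<in> Dset Y H" "tends Y (\<phi> \<circ> c) y"
    by blast
  let ?h = "inv\<^bsub>B.M\<^esub> \<phi> h"
  have hH: "?h \<in> H"
    using h(1) by simp
  \<comment> \<open>Conjugating by the inverse undoes the translation.\<close>
  have "(\<lambda>n. ?h \<otimes>\<^bsub>B.M\<^esub> (\<phi> \<circ> c) n \<otimes>\<^bsub>B.M\<^esub> inv\<^bsub>B.M\<^esub> ?h) = (\<lambda>n. (\<phi> \<circ> u) (n + k))"
  proof
    fix n
    show "?h \<otimes>\<^bsub>B.M\<^esub> (\<phi> \<circ> c) n \<otimes>\<^bsub>B.M\<^esub> inv\<^bsub>B.M\<^esub> ?h = (\<phi> \<circ> u) (n + k)"
      unfolding \<phi>c using \<phi>_closed[OF h(1)] \<phi>_closed[OF uG[of "n + k"]]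
      by (simp add: B.M.m_assoc) (simp add: B.M.inv_solve_left' flip: B.M.m_assoc)
  qed
  moreover have "tends Y (\<lambda>n. ?h \<otimes>\<^bsub>B.M\<^esub> (\<phi> \<circ> c) n \<otimes>\<^bsub>B.M\<^esub> inv\<^bsub>B.M\<^esub> ?h) (?h y)"
    by (rule B.tends_conj[OF hH _ y(2)]) (use cG in simp)
  ultimately have "tends Y (\<lambda>n. (\<phi> \<circ> u) (n + k)) (?h y)"
    by (simp only:)
  then have "tends Y (\<phi> \<circ> u) (?h y)"
    by (simp only: tends_shift)
  then show ?thesis
    using B.Dset_closed[OF hH y(1)] by blast
qed

end

section \<open>The correspondence of points and the homeomorphism it defines\<close>

lemma tends_interlaceD:
  assumes "tends X (interlace u v) x"
  shows "tends X u x" "tends X v x"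
proof -
  have "\<forall>\<^sub>F n in sequentially. P (u n)" "\<forall>\<^sub>F n in sequentially. P (v n)"
    if ev: "\<forall>\<^sub>F n in sequentially. P (interlace u v n)" for P
  proof -
    have "filterlim (\<lambda>n. 2 * n) sequentially sequentially"
      "filterlim (\<lambda>n. 2 * n + 1) sequentially sequentially"
      by (rule filterlim_at_top_mono[OF filterlim_ident], simp)+
    then have "\<forall>\<^sub>F n in sequentially. P (interlace u v (2 * n))"
      "\<forall>\<^sub>F n in sequentially. P (interlace u v (2 * n + 1))"
      using eventually_compose_filterlim[OF ev] by blast+
    then show "\<forall>\<^sub>F n in sequentially. P (u n)" "\<forall>\<^sub>F n in sequentially. P (v n)"
      by (simp_all add: interlace_def)
  qed
  note * = this[where P = "\<lambda>g. moved X g \<subseteq> N" for N]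
  show "tends X u x" "tends X v x"
    using assms * unfolding tends_def by blast+
qed

context isomorphic_pairs
begin

text \<open>A relation rather than a function, so that it reads the same from both sides of the
  isomorphism. One sequence is enough by \<open>corresponds_tends\<close>.\<close>

definition corresponds :: "'a \<Rightarrow> 'b \<Rightarrow> bool" where
  "corresponds x y \<longleftrightarrow> x \<in> Dset X G \<and> y \<in> Dset Y H \<and>
     (\<exists>u. A.nontrivial_seq u \<and> tends X u x \<and> tends Y (\<phi> \<circ> u) y)"

lemma nontrivial_seq_comp: "A.nontrivial_seq u \<Longrightarrow> B.nontrivial_seq (\<phi> \<circ> u)"
  using nontrivial_seq_iff[of u] by (simp add: A.nontrivial_seq_def)

lemma corresponds_total:
  assumes x: "x \<in> Dset X G"
  shows "\<exists>y. corresponds x y"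
proof -
  have "x \<in> topspace X"
    using x by (simp add: Dset_def)
  then obtain u where u: "A.nontrivial_seq u" "tends X u x"
    using A.exists_tends by blast
  then show ?thesis
    using exists_limit[OF u x] x unfolding corresponds_def by blast
qed

text \<open>The limit does not depend on the sequence: interlacing \<open>u\<close> with the
  witnessing \<open>v\<close> still gives a sequence tending to \<open>x\<close>, its image has a
  limit, and both halves share that limit.\<close>

lemma corresponds_tends:
  assumes u: "A.nontrivial_seq u" "tends X u x" and xy: "corresponds x y"
  shows "tends Y (\<phi> \<circ> u) y"
proof -
  obtain v where v: "A.nontrivial_seq v" "tends X v x" "tends Y (\<phi> \<circ> v) y"
    using xy unfolding corresponds_def by blast
  have "x \<in> Dset X G"
    using xy by (simp add: corresponds_def)
  then obtain z where z: "tends Y (\<phi> \<circ> interlace u v) z"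
    using exists_limit[OF A.nontrivial_seq_interlace[OF u(1) v(1)] tends_interlace[OF u(2) v(2)]]
    by blast
  moreover have "\<phi> \<circ> interlace u v = interlace (\<phi> \<circ> u) (\<phi> \<circ> v)"
    by (auto simp: interlace_def)
  ultimately have "tends Y (interlace (\<phi> \<circ> u) (\<phi> \<circ> v)) z"
    by simp
  then have lim: "tends Y (\<phi> \<circ> u) z" "tends Y (\<phi> \<circ> v) z"
    by (rule tends_interlaceD)+
  then have "z = y"
    using B.tends_unique[OF nontrivial_seq_comp[OF v(1)] lim(2) v(3)] by simp
  then show ?thesis
    using lim(1) by simp
qed

lemma corresponds_unique:
  assumes "corresponds x y" "corresponds x y'"
  shows "y = y'"
proof -
  obtain v where v: "A.nontrivial_seq v" "tends X v x" "tends Y (\<phi> \<circ> v) y"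
    using assms(1) unfolding corresponds_def by blast
  then show ?thesis
    using B.tends_unique[OF nontrivial_seq_comp[OF v(1)] v(3)] corresponds_tends[OF v(1,2) assms(2)]
    by simp
qed

lemma corresponds_equivariant:
  assumes g: "g \<in> G" and xy: "corresponds x y"
  shows "corresponds (g x) (\<phi> g y)"
proof -
  obtain u where u: "A.nontrivial_seq u" "tends X u x" "tends Y (\<phi> \<circ> u) y"
    and D: "x \<in> Dset X G" "y \<in> Dset Y H"
    using xy unfolding corresponds_def by blast
  have uG: "u n \<in> G" for n
    using u(1) by (simp add: A.nontrivial_seq_def)
  let ?c = "\<lambda>n. g \<otimes>\<^bsub>A.M\<^esub> u n \<otimes>\<^bsub>A.M\<^esub> inv\<^bsub>A.M\<^esub> g"
  have "\<phi> \<circ> ?c = (\<lambda>n. \<phi> g \<otimes>\<^bsub>B.M\<^esub> (\<phi> \<circ> u) n \<otimes>\<^bsub>B.M\<^esub> inv\<^bsub>B.M\<^esub> \<phi> g)"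
    using \<phi>_conj[OF g uG] by auto
  moreover have "tends Y (\<lambda>n. \<phi> g \<otimes>\<^bsub>B.M\<^esub> (\<phi> \<circ> u) n \<otimes>\<^bsub>B.M\<^esub> inv\<^bsub>B.M\<^esub> \<phi> g) (\<phi> g y)"
    using B.tends_conj[of "\<phi> g" "\<phi> \<circ> u" y] g uG u(3) by simp
  ultimately have "tends Y (\<phi> \<circ> ?c) (\<phi> g y)"
    by (simp only:)
  then show ?thesis
    unfolding corresponds_def
    using A.nontrivial_seq_conj[OF g u(1)] A.tends_conj[OF g uG u(2)]
      A.Dset_closed[OF g D(1)] B.Dset_closed[OF \<phi>_closed[OF g] D(2)] by blast
qed

text \<open>The image of a witnessing sequence is a witness for the inverse isomorphism, and
  conversely.\<close>

lemma corresponds_swap: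
  "isomorphic_pairs.corresponds Y H X G (inv_into G \<phi>) y x \<longleftrightarrow> corresponds x y"
proof -
  interpret S: isomorphic_pairs Y H X G "inv_into G \<phi>"
    by (rule swap)
  have inv_comp: "inv_into G \<phi> \<circ> (\<phi> \<circ> u) = u" if "A.nontrivial_seq u" for u
    using that inj by (auto simp: A.nontrivial_seq_def)
  show ?thesis
  proof
    assume "S.corresponds y x"
    then obtain u where u: "B.nontrivial_seq u" "tends Y u y" "tends X (inv_into G \<phi> \<circ> u) x"
      and D: "x \<in> Dset X G" "y \<in> Dset Y H"
      unfolding S.corresponds_def by blast
    obtain v where v: "A.nontrivial_seq v" "u = \<phi> \<circ> v"
      using seq_preimage[OF u(1)] by blast
    then have "tends X v x" "tends Y (\<phi> \<circ> v) y"
      using u inv_comp[OF v(1)] by simp_all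
    then show "corresponds x y"
      using D v(1) unfolding corresponds_def by blast
  next
    assume "corresponds x y"
    then obtain u where u: "A.nontrivial_seq u" "tends X u x" "tends Y (\<phi> \<circ> u) y"
      and D: "x \<in> Dset X G" "y \<in> Dset Y H"
      unfolding corresponds_def by blast
    then have "tends X (inv_into G \<phi> \<circ> (\<phi> \<circ> u)) x"
      using inv_comp by simp
    then show "S.corresponds y x"
      using D u(3) nontrivial_seq_comp[OF u(1)] unfolding S.corresponds_def by blast
  qed
qed

text \<open>If continuity failed at \<open>x\<close>, there would be points \<open>z\<close>
  arbitrarily near \<open>x\<close> with \<open>\<tau> z\<close> outside \<open>N\<close>. One late
  term from a sequence tending to each such \<open>z\<close> gives a sequence tending to
  \<open>x\<close> whose images avoid the neighborhood \<open>V\<close> of \<open>\<tau> x\<close>,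
  against \<open>corresponds_tends\<close>.\<close>

lemma continuous_map_corresponds:
  assumes \<tau>: "\<And>x. x \<in> Dset X G \<Longrightarrow> corresponds x (\<tau> x)"
  shows "continuous_map (subtopology X (Dset X G)) (subtopology Y (Dset Y H)) \<tau>"
proof -
  have DX: "Dset X G \<subseteq> topspace X" and DY: "Dset Y H \<subseteq> topspace Y"
    by (auto simp: Dset_def)
  have \<tau>D: "\<tau> x \<in> Dset Y H" if "x \<in> Dset X G" for x
    using \<tau>[OF that] by (simp add: corresponds_def)
  have nbhd: "\<exists>W. openin X W \<and> x \<in> W \<and> (\<forall>z\<in>W \<inter> Dset X G. \<tau> z \<in> N)"
    if x: "x \<in> Dset X G" and N: "openin Y N" "\<tau> x \<in> N" for x N
  proof (rule ccontr)
    assume contra: "\<not> ?thesis"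
    obtain B where B: "\<And>n. openin X (B n)" "\<And>n. x \<in> B n"
      "\<And>U. openin X U \<Longrightarrow> x \<in> U \<Longrightarrow> \<forall>\<^sub>F n in sequentially. B n \<subseteq> U"
      using first_countable_shrinking_base[OF A.first_countable subsetD[OF DX x]] by blast
    obtain V where V: "openin Y V" "\<tau> x \<in> V" "Y closure_of V \<subseteq> N"
      using regular_space_closure_nbhd[OF B.regular N] by blast
    have V_sub: "V \<subseteq> Y closure_of V"
      by (rule closure_of_subset[OF openin_subset[OF V(1)]])
    have "\<exists>g\<in>G. g \<noteq> \<one>\<^bsub>A.M\<^esub> \<and> A.supp g \<subseteq> B n \<and> B.supp (\<phi> g) \<inter> V = {}" for n
    proof -
      obtain z where z: "z \<in> B n" "z \<in> Dset X G" "\<tau> z \<notin> N"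
        using contra B(1,2) by blast
      obtain u where u: "A.nontrivial_seq u" "tends X u z" "tends Y (\<phi> \<circ> u) (\<tau> z)"
        using \<tau>[OF z(2)] unfolding corresponds_def by blast
      \<comment> \<open>The closure of \<open>V\<close> lies in \<open>N\<close>, so its complement
        is an open neighborhood of \<open>\<tau> z\<close>.\<close>
      have "openin Y (topspace Y - Y closure_of V)" "\<tau> z \<in> topspace Y - Y closure_of V"
        using z V(3) \<tau>D[OF z(2)] DY by (auto intro: openin_diff)
      then have "\<forall>\<^sub>F n in sequentially. B.supp ((\<phi> \<circ> u) n) \<subseteq> topspace Y - Y closure_of V"
        using u(3) by (simp add: tends_def)
      moreover have "\<forall>\<^sub>F k in sequentially. A.supp (u k) \<subseteq> B n"
        using u(2) B(1) z(1) by (simp add: tends_def)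
      ultimately have "\<forall>\<^sub>F k in sequentially. A.supp (u k) \<subseteq> B n \<and>
          B.supp ((\<phi> \<circ> u) k) \<subseteq> topspace Y - Y closure_of V"
        by (simp add: eventually_conj)
      then obtain k where "A.supp (u k) \<subseteq> B n" "B.supp ((\<phi> \<circ> u) k) \<subseteq> topspace Y - Y closure_of V"
        unfolding eventually_sequentially by blast
      moreover have "u k \<in> G" "u k \<noteq> \<one>\<^bsub>A.M\<^esub>"
        using u(1) by (simp_all add: A.nontrivial_seq_def)
      ultimately show ?thesis
        using V_sub by (intro bexI[of _ "u k"]) auto
    qed
    then obtain w where w: "\<And>n. w n \<in> G" "\<And>n. w n \<noteq> \<one>\<^bsub>A.M\<^esub>" "\<And>n. A.supp (w n) \<subseteq> B n"
      "\<And>n. B.supp (\<phi> (w n)) \<inter> V = {}"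
      by metis
    have nw: "A.nontrivial_seq w"
      using w(1,2) by (simp add: A.nontrivial_seq_def)
    have "tends X w x"
      unfolding tends_def
    proof (intro conjI allI impI subsetD[OF DX x])
      fix U assume "openin X U \<and> x \<in> U"
      then have "\<forall>\<^sub>F n in sequentially. B n \<subseteq> U"
        using B(3) by blast
      then show "\<forall>\<^sub>F n in sequentially. A.supp (w n) \<subseteq> U"
        by (rule eventually_mono) (use w(3) in blast)
    qed
    then have "tends Y (\<phi> \<circ> w) (\<tau> x)"
      by (rule corresponds_tends[OF nw _ \<tau>[OF x]])
    then have "\<forall>\<^sub>F n in sequentially. B.supp ((\<phi> \<circ> w) n) \<inter> V \<noteq> {}"
      using B.tends_meets[OF nontrivial_seq_comp[OF nw] _ V(1,2)] by blast
    then show False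
      using w(4) by simp
  qed
  show ?thesis
    unfolding continuous_map_def
  proof (intro conjI allI impI)
    show "\<tau> \<in> topspace (subtopology X (Dset X G)) \<rightarrow> topspace (subtopology Y (Dset Y H))"
      using \<tau>D DY by auto
    fix U assume "openin (subtopology Y (Dset Y H)) U"
    then obtain N where N: "openin Y N" "U = N \<inter> Dset Y H"
      by (auto simp: openin_subtopology)
    define W where "W = \<Union> {W. openin X W \<and> (\<forall>z\<in>W \<inter> Dset X G. \<tau> z \<in> N)}"
    have "openin X W"
      unfolding W_def by (intro openin_Union) blast
    moreover have "{x \<in> topspace (subtopology X (Dset X G)). \<tau> x \<in> U} = W \<inter> Dset X G"
    proof (intro equalityI subsetI)
      fix x assume "x \<in> {x \<in> topspace (subtopology X (Dset X G)). \<tau> x \<in> U}"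
      then have "x \<in> Dset X G" "\<tau> x \<in> N"
        using N(2) by auto
      then show "x \<in> W \<inter> Dset X G"
        using nbhd[OF _ N(1)] unfolding W_def by blast
    next
      fix x assume "x \<in> W \<inter> Dset X G"
      then have "x \<in> Dset X G" "\<tau> x \<in> N"
        unfolding W_def by blast+
      then show "x \<in> {x \<in> topspace (subtopology X (Dset X G)). \<tau> x \<in> U}"
        using N(2) \<tau>D DX by auto
    qed
    ultimately show "openin (subtopology X (Dset X G)) {x \<in> topspace (subtopology X (Dset X G)). \<tau> x \<in> U}"
      unfolding openin_subtopology by blast
  qed
qed

text \<open>The inverse map comes from the swapped isomorphism, so its continuity is the same lemma
  again. Equivariance holds because \<open>g (\<tau>' y)\<close> corresponds to
  \<open>\<phi> g y\<close>.\<close>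

theorem exists_equivariant_homeomorphism:
  "\<exists>\<tau> \<tau>'. homeomorphic_maps (subtopology X (Dset X G)) (subtopology Y (Dset Y H)) \<tau> \<tau>' \<and>
     (\<forall>g\<in>G. \<forall>y\<in>Dset Y H. \<tau>' y \<in> Dset X G \<and> \<phi> g y = \<tau> (g (\<tau>' y)))"
proof -
  interpret S: isomorphic_pairs Y H X G "inv_into G \<phi>"
    by (rule swap)
  obtain \<tau> where \<tau>: "\<And>x. x \<in> Dset X G \<Longrightarrow> corresponds x (\<tau> x)"
    using corresponds_total by metis
  obtain \<tau>' where \<tau>': "\<And>y. y \<in> Dset Y H \<Longrightarrow> S.corresponds y (\<tau>' y)"
    using S.corresponds_total by metis
  have \<tau>_eq: "\<tau> x = y" if "corresponds x y" for x y
    using corresponds_unique[OF that \<tau>] that by (simp add: corresponds_def)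
  have \<tau>'_eq: "\<tau>' y = x" if "corresponds x y" for x y
    using S.corresponds_unique[OF _ \<tau>', of y x] that corresponds_swap[of y x]
    by (simp add: corresponds_def)
  have \<tau>'_corr: "corresponds (\<tau>' y) y" if "y \<in> Dset Y H" for y
    using \<tau>'[OF that] corresponds_swap by blast
  have "homeomorphic_maps (subtopology X (Dset X G)) (subtopology Y (Dset Y H)) \<tau> \<tau>'"
    unfolding homeomorphic_maps_def
    using continuous_map_corresponds[OF \<tau>] S.continuous_map_corresponds[OF \<tau>']
      \<tau>'_eq[OF \<tau>] \<tau>_eq[OF \<tau>'_corr] by simp
  moreover have "\<tau>' y \<in> Dset X G \<and> \<phi> g y = \<tau> (g (\<tau>' y))" if "g \<in> G" "y \<in> Dset Y H" for g y
    using \<tau>_eq[OF corresponds_equivariant[OF that(1) \<tau>'_corr[OF that(2)]]] \<tau>'_corr[OF that(2)]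
    by (simp add: corresponds_def)
  ultimately show ?thesis
    by blast
qed

end

section \<open>The classes \<open>K_1\<close> and \<open>K_class\<close>\<close>

lemma K_class_flexible_pair: "K_class X G \<Longrightarrow> flexible_pair X G"
  by unfold_locales (simp_all add: K_class_def)

text \<open>Once there is a second point \<open>y\<close>, the set in \<open>DF X G x y\<close> is
  part of the orbit of \<open>x\<close>. Such a point exists because local movement provides some
  \<open>g\<close> moving a point \<open>z\<close>, and \<open>z\<close> and \<open>g z\<close>
  cannot both be \<open>x\<close>.\<close>

lemma K_1_Dset:
  assumes "K_1 X G"
  shows "Dset X G = topspace X"
proof -
  interpret moving_pair X G
    using assms by unfold_locales (simp_all add: K_1_def)
  have "x \<in> Dset X G" if x: "x \<in> topspace X" for x
  proof -
    obtain g where g: "g \<in> G" "g \<noteq> \<one>\<^bsub>M\<^esub>"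
      using exists_supported[OF openin_topspace] x by blast
    then obtain z where z: "z \<in> topspace X" "g z \<noteq> z"
      using moved_eq_empty[OF g(1)] by (auto simp: moved_def)
    then obtain y where "y \<in> topspace X" "x \<noteq> y"
      using g(1) by (metis apply_closed)
    then have "DF X G x y"
      using assms x by (simp add: K_1_def)
    then have "X interior_of (X closure_of {g x |g. g \<in> G \<and> id_near X g y}) \<noteq> {}"
      by (simp add: DF_def somewhere_dense_def)
    moreover have "X interior_of (X closure_of {g x |g. g \<in> G \<and> id_near X g y})
        \<subseteq> X interior_of (X closure_of {g x |g. g \<in> G})"
      by (intro interior_of_mono closure_of_mono) blast
    ultimately show ?thesis
      using x by (auto simp: Dset_def somewhere_dense_def)
  qed
  then show ?thesis
    by (auto simp: Dset_def)
qed

lemma K_1_flexible_pair: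
  assumes "K_1 X G"
  shows "flexible_pair X G"
  using assms K_1_Dset[OF assms] by unfold_locales (simp_all add: K_1_def)

lemma equivariant_homeomorphism:
  assumes "flexible_pair X G" "flexible_pair Y H" "\<phi> \<in> iso (group_of X G) (group_of Y H)"
  shows "\<exists>\<tau> \<tau>'. homeomorphic_maps (subtopology X (Dset X G)) (subtopology Y (Dset Y H)) \<tau> \<tau>' \<and>
     (\<forall>g\<in>G. \<forall>y\<in>Dset Y H. \<tau>' y \<in> Dset X G \<and> \<phi> g y = \<tau> (g (\<tau>' y)))"
  using isomorphic_pairs.exists_equivariant_homeomorphism[of X G Y H \<phi>] assms
  by (simp add: isomorphic_pairs_def isomorphic_pairs_axioms_def)

lemma faithful_K_1: "faithful K_1 K_1"
  unfolding faithful_def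
proof (intro allI impI)
  fix X :: "'a topology" and G and Y :: "'b topology" and H and \<phi>
  assume K: "K_1 X G" "K_1 Y H" and \<phi>: "\<phi> \<in> iso (group_of X G) (group_of Y H)"
  obtain \<tau> \<tau>' where homeo: "homeomorphic_maps X Y \<tau> \<tau>'"
    and eq: "\<And>g y. g \<in> G \<Longrightarrow> y \<in> topspace Y \<Longrightarrow> \<phi> g y = \<tau> (g (\<tau>' y))"
    using equivariant_homeomorphism[OF K_1_flexible_pair[OF K(1)] K_1_flexible_pair[OF K(2)] \<phi>]
    by (auto simp: K_1_Dset[OF K(1)] K_1_Dset[OF K(2)])
  interpret B: flexible_pair Y H
    by (rule K_1_flexible_pair[OF K(2)])
  have "\<phi> g = restrict (\<tau> \<circ> g \<circ> \<tau>') (topspace Y)" if "g \<in> G" for g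
  proof -
    have "\<phi> g \<in> H"
      using \<phi> that by (auto simp: iso_def hom_def group_of_def)
    \<comment> \<open>Both sides are \<open>undefined\<close> off the space, so agreement of values
      becomes equality of functions.\<close>
    then have "\<phi> g \<in> extensional (topspace Y)"
      using B.G_homeo by (auto simp: Bij_def)
    then show ?thesis
      using eq[OF that] by (intro extensionalityI[of _ "topspace Y"]) auto
  qed
  then show "\<exists>\<tau> \<tau>'. homeomorphic_maps X Y \<tau> \<tau>' \<and>
      (\<forall>g\<in>G. \<phi> g = restrict (\<tau> \<circ> g \<circ> \<tau>') (topspace Y))"
    using homeo by blast
qed

theorem theorem2p3:
  shows "(faithful (K_1 :: 'a topology \<Rightarrow> ('a \<Rightarrow> 'a) set \<Rightarrow> bool)
                  (K_1 :: 'b topology \<Rightarrow> ('b \<Rightarrow> 'b) set \<Rightarrow> bool)) \<and>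
         (\<forall>(X1 :: 'a topology) G1 (X2 :: 'b topology) G2 \<phi>.
           K_class X1 G1 \<longrightarrow> K_class X2 G2 \<longrightarrow> \<phi> \<in> iso (group_of X1 G1) (group_of X2 G2) \<longrightarrow>
           (\<exists>\<tau> \<tau>'. homeomorphic_maps (subtopology X1 (Dset X1 G1)) (subtopology X2 (Dset X2 G2)) \<tau> \<tau>' \<and>
              (\<forall>g\<in>G1. restrict (\<phi> g) (Dset X2 G2) =
                 restrict (\<tau> \<circ> restrict g (Dset X1 G1) \<circ> \<tau>') (Dset X2 G2))))"
proof (intro conjI allI impI)
  fix X1 :: "'a topology" and G1 and X2 :: "'b topology" and G2 and \<phi>
  assume K: "K_class X1 G1" "K_class X2 G2" and \<phi>: "\<phi> \<in> iso (group_of X1 G1) (group_of X2 G2)"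
  obtain \<tau> \<tau>' where homeo:
      "homeomorphic_maps (subtopology X1 (Dset X1 G1)) (subtopology X2 (Dset X2 G2)) \<tau> \<tau>'"
    and eq: "\<forall>g\<in>G1. \<forall>y\<in>Dset X2 G2. \<tau>' y \<in> Dset X1 G1 \<and> \<phi> g y = \<tau> (g (\<tau>' y))"
    using equivariant_homeomorphism[OF K_class_flexible_pair[OF K(1)] K_class_flexible_pair[OF K(2)] \<phi>]
    by blast
  have "restrict (\<phi> g) (Dset X2 G2) = restrict (\<tau> \<circ> restrict g (Dset X1 G1) \<circ> \<tau>') (Dset X2 G2)"
    if "g \<in> G1" for g
    \<comment> \<open>\<open>\<tau>' y\<close> lies in \<open>Dset X1 G1\<close>, so the inner
      restriction returns the value of \<open>g\<close> and not \<open>undefined\<close>.\<close>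
    using eq that by (intro restrict_ext) auto
  then show "\<exists>\<tau> \<tau>'. homeomorphic_maps (subtopology X1 (Dset X1 G1)) (subtopology X2 (Dset X2 G2)) \<tau> \<tau>' \<and>
      (\<forall>g\<in>G1. restrict (\<phi> g) (Dset X2 G2) =
         restrict (\<tau> \<circ> restrict g (Dset X1 G1) \<circ> \<tau>') (Dset X2 G2))"
    using homeo by blast
qed (rule faithful_K_1)

end
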